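(* Let $m>n\ge 1$, $A\in\mathbb{R}^{m\times n}$, $b\in\mathbb{R}^m$ satisfy $0<\sigma_{n+1}<\hat\sigma_n$, let $x$ be the TLS solution, and put $\alpha=\frac{1}{\sqrt{1+\|x\|^2}}$. Assume that $\alpha\le\frac12$, and denote $\rho=\frac{\sigma_{n+1}}{\sigma_n}$. Then $$\underline{\kappa}_2:=\frac{\sqrt{1+\|x\|^2}}{\sqrt{\hat\sigma_n^2-\sigma_{n+1}^2}}\le\kappa_g(A,b)<\bar{\kappa}_2:=\sqrt{\frac{1+31\rho^2}{1-\rho^2}}\;\frac{\sqrt{1+\|x\|^2}}{\sqrt{\hat\sigma_n^2-\sigma_{n+1}^2}}.$$
   Context: $\|\cdot\|$ is the Euclidean norm for vectors and the spectral norm for matrices; $\|\cdot\|_F$ is the Frobenius norm. $\hat\sigma_1\ge\cdots\ge\hat\sigma_n$ are the singular values of $A$ and $\sigma_1\ge\cdots\ge\sigma_{n+1}$ are the singular values of $[A\ \,b]\in\mathbb{R}^{m\times(n+1)}$. The total least squares (TLS) problem is $\min\|[E\ \,r]\|_F$ subject to $b-r\in\mathcal{R}(A+E)$ ($\mathcal R$ = range); under $\sigma_{n+1}<\hat\sigma_n$ its unique solution is $x=(A^TA-\sigma_{n+1}^2I_n)^{-1}A^Tb$. Absolute condition number: for $(\tilde A,\tilde b)$ in a small neighbourhood of $(A,b)$, let $\tilde\sigma_{n+1}$ be the smallest singular value of $[\tilde A\ \,\tilde b]$ and let $g:\mathbb{R}^{m(n+1)}\to\mathbb{R}^n$ be the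 map $[\mathrm{vec}(\tilde A)^T,\tilde b^T]^T\mapsto(\tilde A^T\tilde A-\tilde\sigma_{n+1}^2I_n)^{-1}\tilde A^T\tilde b$, i.e. the TLS solution map, where $\mathrm{vec}$ stacks columns. Then $\kappa_g(A,b):=\|g'([\mathrm{vec}(A)^T,b^T]^T)\|$, the spectral norm of the derivative of $g$ at $(A,b)$. *)

theory Defs
  imports
    "HOL-Analysis.Analysis"
    "HOL-Computational_Algebra.Polynomial"
    "HOL-Library.Multiset"
begin

definition charpoly :: "real^'n^'n \<Rightarrow> real poly" where
  "charpoly S = det (\<chi> i j. (if i = j then [:0, 1:] else 0) - [:S $ i $ j:])"

text \<open>
  The singular values of a matrix \<open>M\<close> with at least as many rows as columns are the square roots
  of the eigenvalues of \<open>M\<^sup>T M\<close>, counted with multiplicity and listed in decreasing order.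
  (\<open>M\<^sup>T M\<close> is symmetric and positive semidefinite, so \<^term>\<open>proots\<close> of its characteristic
  polynomial has one nonnegative element for each column of \<open>M\<close>.)
  If \<open>M\<close> had more columns than rows, the list would be padded with zeros.
\<close>

definition singular_values :: "real^'n^'m \<Rightarrow> real list" where
  "singular_values M =
     rev (sorted_list_of_multiset (image_mset sqrt (proots (charpoly (transpose M ** M)))))"

text \<open>The index of \<open>singular_value M k\<close> starts at \<open>1\<close>.\<close>

definition singular_value :: "real^'n^'m \<Rightarrow> nat \<Rightarrow> real" where
  "singular_value M k = singular_values M ! (k - 1)"

text \<open>
  The matrix \<open>[A b]\<close>: the columns of \<open>A\<close> are indexed by \<open>Some j\<close>, the additional column \<open>b\<close>
  by \<open>None\<close>.
\<close>

definition augment :: "real^'n^'m \<Rightarrow> real^'m \<Rightarrow> real^('n option)^'m" where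
  "augment A b = (\<chi> i k. case k of None \<Rightarrow> b $ i | Some j \<Rightarrow> A $ i $ j)"

text \<open>
  \<open>x\<close> solves the total least squares problem if it realises the constraint for some minimiser
  \<open>(E, r)\<close>. Note that \<^term>\<open>norm\<close> on \<^typ>\<open>real^'k^'m\<close> is the Frobenius norm.
\<close>

definition tls_feasible :: "real^'n^'m \<Rightarrow> real^'m \<Rightarrow> real^'n^'m \<Rightarrow> real^'m \<Rightarrow> bool" where
  "tls_feasible A b E r \<longleftrightarrow> b - r \<in> range ((*v) (A + E))"

definition is_tls_solution :: "real^'n^'m \<Rightarrow> real^'m \<Rightarrow> real^'n \<Rightarrow> bool" where
  "is_tls_solution A b x \<longleftrightarrow>
     (\<exists>E r. tls_feasible A b E r \<and>
       (\<forall>E' r'. tls_feasible A b E' r' \<longrightarrow> norm (augment E r) \<le> norm (augment E' r')) \<and>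
       (A + E) *v x = b - r)"

definition tls_map :: "(real^'n^'m) \<times> (real^'m) \<Rightarrow> real^'n" where
  "tls_map = (\<lambda>(A, b).
     matrix_inv (transpose A ** A - mat ((singular_value (augment A b) (CARD('n) + 1))\<^sup>2))
       *v (transpose A *v b))"

text \<open>
  The norm on \<^typ>\<open>(real^'n^'m) \<times> (real^'m)\<close> is \<open>(A, b) \<mapsto> sqrt ((norm A)\<^sup>2 + (norm b)\<^sup>2)\<close> with the
  Frobenius norm of \<open>A\<close>, i.e.\ the Euclidean norm of the vector that stacks the columns of \<open>A\<close>
  and \<open>b\<close>. Hence \<^term>\<open>onorm\<close> of the derivative is the spectral norm of the Jacobian with
  respect to these stacked coordinates.
\<close>

definition tls_cond :: "real^'n^'m \<Rightarrow> real^'m \<Rightarrow> real" where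
  "tls_cond A b = onorm (frechet_derivative tls_map (at (A, b)))"

end

theory Submission
  imports Defs
begin

text \<open>
  Write \<open>C = [A b]\<close>, let \<open>s\<close>, \<open>\<mu>\<close> be its smallest and second smallest singular values, \<open>\<sigma>\<close> the smallest
  singular value of \<open>A\<close>, \<open>r = A x - b\<close>, \<open>\<beta> = 1 + |x|\<^sup>2\<close> and \<open>K = A\<^sup>T A - s\<^sup>2 I\<close>. The vector \<open>z = (x, -1)\<close> is
  a right singular vector of \<open>C\<close> for \<open>s\<close>, and \<open>s\<^sup>2\<close> is a simple eigenvalue, hence differentiable.
  Differentiating \<open>K x = A\<^sup>T b\<close> shows that the derivative of the solution map in direction \<open>(E, f)\<close> is
  \<open>- K\<inverse> T (E, f)\<close> with \<open>T (E, f) = E\<^sup>T r + A\<^sup>T d - (2/\<beta>) (r \<bullet> d) x\<close> and \<open>d = E x - f\<close>. Therefore the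
  condition number is the maximum of \<open>|T\<^sup>* y| / |K y|\<close>, where
  \<open>|T\<^sup>* y|\<^sup>2 = \<beta> (|A y|\<^sup>2 + s\<^sup>2 |y|\<^sup>2) - 2 s\<^sup>2 (x \<bullet> y)\<^sup>2\<close>.

  The lower bound comes from testing with the last right singular vector of \<open>A\<close>. For the upper
  bound let \<open>w\<close> be the component of \<open>(y, 0)\<close> orthogonal to \<open>z\<close>. Then
  \<open>|T\<^sup>* y|\<^sup>2 = \<beta> (|C w|\<^sup>2 + s\<^sup>2 |w|\<^sup>2)\<close> and \<open>y \<bullet> K y = |C w|\<^sup>2 - s\<^sup>2 |w|\<^sup>2\<close>, and \<open>|C w| \<ge> \<mu> |w|\<close> bounds the
  ratio of the two by \<open>\<beta> (\<mu>\<^sup>2 + s\<^sup>2) / (\<mu>\<^sup>2 - s\<^sup>2)\<close>; finally \<open>(\<sigma>\<^sup>2 - s\<^sup>2) (y \<bullet> K y) \<le> |K y|\<^sup>2\<close>.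
\<close>

section \<open>Singular values and singular vectors\<close>

lemma transpose_vector_inner:
  fixes M :: "real^'k^'m"
  shows "(transpose M *v w) \<bullet> y = w \<bullet> (M *v y)"
  by (simp add: dot_lmul_matrix)

lemma inner_gram:
  fixes M :: "real^'k^'m"
  shows "y \<bullet> ((transpose M ** M) *v w) = (M *v y) \<bullet> (M *v w)"
proof -
  have "y \<bullet> ((transpose M ** M) *v w) = (transpose M *v (M *v w)) \<bullet> y"
    by (simp only: matrix_vector_mul_assoc[symmetric] inner_commute)
  also have "\<dots> = (M *v w) \<bullet> (M *v y)" by (rule transpose_vector_inner)
  finally show ?thesis by (simp only: inner_commute)
qed

text \<open>For small \<open>t\<close> of the sign opposite to \<open>a\<close> the linear term
  outweighs the quadratic one; \<open>t = - a / d\<close> with \<open>d > \<bar>c\<bar>\<close> is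
  small enough.\<close>

lemma nonneg_quadratic_imp_linear_zero:
  fixes a c :: real
  assumes "\<And>t. 0 \<le> 2 * t * a + t\<^sup>2 * c"
  shows "a = 0"
proof (rule ccontr)
  assume "a \<noteq> 0"
  define d where "d = \<bar>c\<bar> + 1"
  have "d > 0" by (simp add: d_def)
  have "0 \<le> 2 * (- a / d) * a + (- a / d)\<^sup>2 * c" by (rule assms)
  also have "\<dots> = a\<^sup>2 / d\<^sup>2 * (c - 2 * d)"
    using \<open>d > 0\<close> by (simp add: field_simps power2_eq_square)
  finally have "0 \<le> a\<^sup>2 / d\<^sup>2 * (c - 2 * d)" .
  moreover have "a\<^sup>2 / d\<^sup>2 > 0" "c - 2 * d < 0" using \<open>a \<noteq> 0\<close> by (auto simp: d_def)
  ultimately show False by (smt (verit) mult_pos_neg)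
qed

text \<open>A zero of a nonnegative quadratic form is a minimiser, so every first variation vanishes
  there. In the direction \<open>g v\<close> the first variation is a multiple of the squared norm
  of \<open>g v\<close>. This turns minimisers of Rayleigh quotients into eigenvectors.\<close>

lemma semidefinite_kernel:
  fixes g :: "'a::euclidean_space \<Rightarrow> 'a"
  assumes lin: "linear g" and V: "subspace V" and gV: "\<And>x. x \<in> V \<Longrightarrow> g x \<in> V"
    and sym: "\<And>x y. x \<bullet> g y = g x \<bullet> y"
    and psd: "\<And>x. x \<in> V \<Longrightarrow> 0 \<le> x \<bullet> g x"
    and v: "v \<in> V" "v \<bullet> g v = 0"
  shows "g v = 0"
proof -
  have "g v \<bullet> g v = 0"
  proof (rule nonneg_quadratic_imp_linear_zero)
    fix t :: real
    have "0 \<le> (v + t *\<^sub>R g v) \<bullet> g (v + t *\<^sub>R g v)"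
      by (intro psd subspace_add subspace_scale V v gV)
    also have "\<dots> = v \<bullet> g v + t * (v \<bullet> g (g v)) + t * (g v \<bullet> g v) + t\<^sup>2 * (g v \<bullet> g (g v))"
      by (simp add: linear_add[OF lin] linear_scale[OF lin] inner_simps power2_eq_square
          algebra_simps)
    also have "\<dots> = 2 * t * (g v \<bullet> g v) + t\<^sup>2 * (g v \<bullet> g (g v))"
      using v sym[of v "g v"] by simp
    finally show "0 \<le> 2 * t * (g v \<bullet> g v) + t\<^sup>2 * (g v \<bullet> g (g v))" .
  qed
  thus ?thesis by simp
qed

text \<open>The Rayleigh quotient attains its minimum \<open>c\<close> on the compact unit sphere of
  \<open>V\<close>; then \<open>f - c\<close> is semidefinite on \<open>V\<close> and its form
  vanishes at the minimiser.\<close>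

lemma self_adjoint_eigenvector:
  fixes f :: "'a::euclidean_space \<Rightarrow> 'a"
  assumes lin: "linear f" and V: "subspace V" and fV: "\<And>x. x \<in> V \<Longrightarrow> f x \<in> V"
    and sym: "\<And>x y. x \<bullet> f y = f x \<bullet> y"
    and nz: "V \<noteq> {0}"
  obtains v c where "v \<in> V" "norm v = 1" "f v = c *\<^sub>R v"
proof -
  let ?S = "V \<inter> sphere 0 1"
  obtain w where "w \<in> V" "w \<noteq> 0" using nz subspace_0[OF V] by blast
  hence "w /\<^sub>R norm w \<in> ?S" using subspace_scale[OF V] by simp
  hence ne: "?S \<noteq> {}" by blast
  have "compact ?S" using closed_subspace[OF V] by (simp add: closed_Int_compact)
  moreover have "continuous_on ?S (\<lambda>x. x \<bullet> f x)"
    by (intro continuous_intros linear_continuous_on) (simp add: lin linear_linear)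
  ultimately obtain v where v: "v \<in> ?S" and min: "\<And>y. y \<in> ?S \<Longrightarrow> v \<bullet> f v \<le> y \<bullet> f y"
    using continuous_attains_inf[of ?S "\<lambda>x. x \<bullet> f x"] ne by blast
  define c where "c = v \<bullet> f v"
  define g where "g = (\<lambda>x. f x - c *\<^sub>R x)"
  have "g v = 0"
  proof (rule semidefinite_kernel[where V = V and g = g and v = v])
    show "linear g" unfolding g_def by (intro linear_compose_sub lin linear_scaleR)
    show "subspace V" by fact
    show "g x \<in> V" if "x \<in> V" for x
      unfolding g_def using that by (intro subspace_diff V fV subspace_scale)
    show "x \<bullet> g y = g x \<bullet> y" for x y by (simp add: g_def inner_simps sym)
    show "0 \<le> x \<bullet> g x" if "x \<in> V" for x
    proof (cases "x = 0")
      case False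
      have "x /\<^sub>R norm x \<in> ?S" using that False subspace_scale[OF V] by simp
      hence "c \<le> (x /\<^sub>R norm x) \<bullet> f (x /\<^sub>R norm x)" unfolding c_def by (rule min)
      also have "\<dots> = (x \<bullet> f x) / (norm x)\<^sup>2"
        by (simp add: linear_scale[OF lin] power2_eq_square divide_simps)
      finally show ?thesis
        using False by (simp add: g_def inner_simps dot_square_norm pos_le_divide_eq)
    qed simp
    show "v \<in> V" using v by simp
    show "v \<bullet> g v = 0" using v by (simp add: g_def inner_simps c_def dot_square_norm)
  qed
  thus ?thesis using that[of v c] v by (simp add: g_def)
qed

text \<open>Split off one eigenvector and recurse: its orthogonal complement \<open>W\<close> in
  \<open>V\<close> has smaller dimension and is invariant because \<open>f\<close> is
  self-adjoint.\<close>

lemma self_adjoint_orthonormal_eigenbasis: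
  fixes f :: "'a::euclidean_space \<Rightarrow> 'a"
  assumes lin: "linear f" and sym: "\<And>x y. x \<bullet> f y = f x \<bullet> y"
    and "subspace V" and "\<And>x. x \<in> V \<Longrightarrow> f x \<in> V"
  shows "\<exists>B\<subseteq>V. pairwise orthogonal B \<and> (\<forall>v\<in>B. norm v = 1 \<and> (\<exists>c. f v = c *\<^sub>R v)) \<and> span B = V"
  using assms(3,4)
proof (induction "dim V" arbitrary: V rule: less_induct)
  case less
  note V = \<open>subspace V\<close>
  show ?case
  proof (cases "V = {0}")
    case True
    thus ?thesis by (intro exI[of _ "{}"]) auto
  next
    case False
    then obtain v c where v: "v \<in> V" "norm v = 1" "f v = c *\<^sub>R v"
      using self_adjoint_eigenvector[OF lin V less.prems(2) sym] by blast
    define W where "W = V \<inter> {y. v \<bullet> y = 0}"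
    have W: "subspace W" unfolding W_def by (intro subspace_inter V subspace_hyperplane)
    have vv: "v \<bullet> v = 1" using v by (simp add: dot_square_norm)
    have "v \<notin> W" using vv by (simp add: W_def)
    hence "W \<subset> V" using v(1) unfolding W_def by blast
    hence "dim W < dim V"
      using W V by (simp add: dim_psubset span_eq_iff[THEN iffD2])
    moreover have "f y \<in> W" if "y \<in> W" for y
      using that less.prems(2) sym[of v y] v by (auto simp: W_def)
    ultimately obtain B where B: "B \<subseteq> W" "pairwise orthogonal B"
        "\<And>v. v \<in> B \<Longrightarrow> norm v = 1 \<and> (\<exists>c. f v = c *\<^sub>R v)" "span B = W"
      using less.hyps W by metis
    have "span (insert v B) = V"
    proof
      show "span (insert v B) \<subseteq> V" using B v V by (intro span_minimal) (auto simp: W_def)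
      show "V \<subseteq> span (insert v B)"
      proof
        fix y assume "y \<in> V"
        hence "y - (v \<bullet> y) *\<^sub>R v \<in> W"
          using v vv V by (auto simp: W_def inner_simps intro: subspace_diff subspace_scale)
        thus "y \<in> span (insert v B)" using B(4) unfolding span_insert by blast
      qed
    qed
    moreover have "pairwise orthogonal (insert v B)"
      using B(1,2) by (auto simp: pairwise_insert orthogonal_def W_def inner_commute)
    ultimately show ?thesis
      using B v by (intro exI[of _ "insert v B"]) (auto simp: W_def)
  qed
qed

text \<open>The eigenbasis has as many elements as the index type, so it can be indexed by that type
  and later serve as the columns of a square matrix.\<close>

theorem symmetric_matrix_diagonalisation:
  fixes S :: "real^'k^'k"
  assumes "transpose S = S"
  obtains u :: "'k \<Rightarrow> real^'k" and d :: "'k \<Rightarrow> real"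
  where "\<And>i j. u i \<bullet> u j = (if i = j then 1 else 0)" "\<And>i. S *v u i = d i *\<^sub>R u i"
proof -
  obtain B :: "(real^'k) set" where B: "pairwise orthogonal B"
      "\<forall>v\<in>B. norm v = 1 \<and> (\<exists>c. S *v v = c *\<^sub>R v)" "span B = UNIV"
    using self_adjoint_orthonormal_eigenbasis[of "(*v) S" UNIV]
    by (metis (no_types, lifting) UNIV_I assms matrix_vector_mul_linear subspace_UNIV
        transpose_vector_inner)
  have ind: "independent B"
    using B by (intro pairwise_orthogonal_independent) auto
  have "card B = CARD('k)"
    by (metis B(3) DIM_cart DIM_real dim_UNIV dim_span_eq_card_independent ind mult.right_neutral)
  moreover have "finite B" using ind by (rule independent_imp_finite)
  ultimately obtain u :: "'k \<Rightarrow> real^'k" where u: "bij_betw u UNIV B"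
    by (metis finite_same_card_bij finite_class.finite_UNIV)
  hence uB: "u i \<in> B" for i by (auto simp: bij_betw_def)
  have "u i \<bullet> u j = (if i = j then 1 else 0)" for i j
  proof (cases "i = j")
    case True
    thus ?thesis using B(2) uB by (simp add: dot_square_norm)
  next
    case False
    hence "u i \<noteq> u j" using u by (auto simp: bij_betw_def inj_def)
    thus ?thesis using False B(1) uB unfolding pairwise_def orthogonal_def by auto
  qed
  moreover from B(2) uB have "\<exists>c. S *v u i = c *\<^sub>R u i" for i by blast
  ultimately show ?thesis using that by metis
qed

section \<open>Singular values as square roots of Gram eigenvalues, with an orthonormal
  eigenbasis\<close>

lemma poly_charpoly:
  fixes S :: "real^'k^'k"
  shows "poly (charpoly S) t = det (mat t - S)"
proof -
  have entry: "poly ((if i = j then [:0, 1:] else 0) - [:S $ i $ j:]) t = (mat t - S) $ i $ j"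
    for i j by (simp add: mat_def)
  \<comment> \<open>The signs of the permutations enter the determinant through
    \<open>of_int\<close>, and evaluation must leave them fixed.\<close>
  have "poly (of_int k) t = of_int k" for k by (simp add: of_int_poly)
  thus ?thesis
    by (simp only: charpoly_def det_def poly_sum poly_mult poly_prod vec_lambda_beta entry)
qed

text \<open>With the eigenvectors as columns of \<open>P\<close>, \<open>mat t - S\<close> is
  intertwined with a diagonal matrix, and the nonzero \<open>det P\<close> cancels. Agreement at
  every real \<open>t\<close> identifies the polynomials.\<close>

lemma charpoly_orthonormal_eigenbasis:
  fixes S :: "real^'k^'k" and u :: "'k \<Rightarrow> real^'k"
  assumes orth: "\<And>i j. u i \<bullet> u j = (if i = j then 1 else 0)"
    and eig: "\<And>i. S *v u i = d i *\<^sub>R u i"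
  shows "charpoly S = (\<Prod>i\<in>UNIV. [:- d i, 1:])"
proof -
  define P :: "real^'k^'k" where "P = (\<chi> i j. u j $ i)"
  define D :: "real \<Rightarrow> real^'k^'k" where "D t = (\<chi> i j. if i = j then t - d i else 0)" for t
  have PtP: "transpose P ** P = mat 1"
    using orth by (simp add: vec_eq_iff P_def matrix_matrix_mult_def transpose_def mat_def inner_vec_def)
  have "det (mat t - S) = (\<Prod>i\<in>UNIV. t - d i)" for t
  proof -
    have "(S ** P) $ i $ j = d j * u j $ i" for i j
    proof -
      have "(S ** P) $ i $ j = (S *v u j) $ i"
        by (simp add: P_def matrix_matrix_mult_def matrix_vector_mult_def)
      thus ?thesis by (simp add: eig)
    qed
    moreover have "(mat t ** P) $ i $ j = t * u j $ i" for i j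
      by (simp add: P_def matrix_matrix_mult_def mat_def if_distrib if_distribR sum.delta'
          cong: if_cong)
    moreover have "(P ** D t) $ i $ j = (t - d j) * u j $ i" for i j
      by (simp add: P_def D_def matrix_matrix_mult_def if_distrib sum.delta cong: if_cong)
    moreover have "((mat t - S) ** P) $ i $ j = (mat t ** P) $ i $ j - (S ** P) $ i $ j" for i j
      by (simp add: matrix_matrix_mult_def sum_subtractf left_diff_distrib)
    ultimately have "((mat t - S) ** P) $ i $ j = (P ** D t) $ i $ j" for i j
      by (simp add: left_diff_distrib)
    hence "(mat t - S) ** P = P ** D t" by (simp add: vec_eq_iff)
    hence "det (mat t - S) * det P = det P * det (D t)" by (metis det_mul)
    moreover have "det P \<noteq> 0" by (metis PtP det_I det_mul mult_zero_right zero_neq_one)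
    ultimately have "det (mat t - S) = det (D t)" by simp
    also have "\<dots> = (\<Prod>i\<in>UNIV. t - d i)" by (subst det_diagonal) (auto simp: D_def)
    finally show ?thesis .
  qed
  hence "poly (charpoly S) = poly (\<Prod>i\<in>UNIV. [:- d i, 1:])"
    by (simp add: fun_eq_iff poly_charpoly poly_prod)
  thus ?thesis by (simp only: poly_eq_poly_eq_iff)
qed

text \<open>The bridge from the list of roots in the definition to eigenvectors: the roots with
  multiplicity are exactly the eigenvalues of an orthonormal eigenbasis, which only has to be
  reordered.\<close>

theorem singular_system:
  fixes M :: "real^'k^'m"
  obtains u :: "nat \<Rightarrow> real^'k"
  where "\<And>i j. i \<in> {1..CARD('k)} \<Longrightarrow> j \<in> {1..CARD('k)} \<Longrightarrow> u i \<bullet> u j = (if i = j then 1 else 0)"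
    and "\<And>i. i \<in> {1..CARD('k)} \<Longrightarrow>
           (transpose M ** M) *v u i = (singular_value M i)\<^sup>2 *\<^sub>R u i"
    and "\<And>i j. 1 \<le> i \<Longrightarrow> i \<le> j \<Longrightarrow> j \<le> CARD('k) \<Longrightarrow> singular_value M j \<le> singular_value M i"
    and "\<And>i. i \<in> {1..CARD('k)} \<Longrightarrow> 0 \<le> singular_value M i"
proof -
  let ?S = "transpose M ** M"
  have "transpose ?S = ?S" by (simp add: matrix_transpose_mul)
  then obtain w d where w: "\<And>i j. w i \<bullet> w j = (if i = j then 1 else 0)"
      "\<And>i::'k. ?S *v w i = d i *\<^sub>R w i"
    using symmetric_matrix_diagonalisation by metis
  have d_nonneg: "0 \<le> d i" for i
  proof -
    have "d i = w i \<bullet> (?S *v w i)" using w by simp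
    thus ?thesis by (simp add: inner_gram)
  qed
  define g where "g = (\<lambda>i. sqrt (d i))"
  have "proots (charpoly ?S) = image_mset d (mset_set UNIV)"
  proof -
    have "proots (charpoly ?S) = (\<Sum>i\<in>UNIV. proots [:- d i, 1:])"
      unfolding charpoly_orthonormal_eigenbasis[OF w] by (rule proots_prod) auto
    also have "\<dots> = (\<Sum>i\<in>UNIV. {#d i#})" by simp
    also have "\<dots> = image_mset d (mset_set UNIV)" by (simp add: sum_unfold_sum_mset)
    finally show ?thesis .
  qed
  hence ms: "image_mset sqrt (proots (charpoly ?S)) = image_mset g (mset_set UNIV)"
    by (simp add: g_def multiset.map_comp comp_def)
  obtain xs :: "'k list" where xs: "set xs = UNIV" "distinct xs"
    using finite_distinct_list[of "UNIV :: 'k set"] by auto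
  \<comment> \<open>Sorting the indices instead of the values keeps each eigenvector attached to its
    value, also when values coincide. Entry \<open>i - 1\<close> of \<open>ys\<close> belongs to the
    singular value number \<open>i\<close>.\<close>
  define ys where "ys = rev (sort_key g xs)"
  have ys: "set ys = UNIV" "distinct ys" "sorted (map g (rev ys))"
    using xs by (auto simp: ys_def)
  have len: "length ys = CARD('k)" using ys by (metis distinct_card)
  have "mset_set (UNIV :: 'k set) = mset (rev ys)" using ys by (metis mset_rev mset_set_set)
  hence "sorted_list_of_multiset (image_mset g (mset_set UNIV)) = sort (map g (rev ys))"
    by (metis mset_map sorted_list_of_multiset_mset)
  also have "\<dots> = rev (map g ys)" using ys(3) by (simp add: sorted_sort_id rev_map)
  finally have svs: "singular_values M = map g ys"
    by (simp add: singular_values_def ms)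
  have lt: "i - 1 < length ys" if "i \<in> {1..CARD('k)}" for i
    using that len by (cases i) auto
  have sv: "singular_value M i = g (ys ! (i - 1))" if "i \<in> {1..CARD('k)}" for i
    using lt[OF that] unfolding singular_value_def svs by (rule nth_map)
  show ?thesis
  proof (rule that[of "\<lambda>i. w (ys ! (i - 1))"], goal_cases)
    case (1 i j)
    hence "ys ! (i - 1) = ys ! (j - 1) \<longleftrightarrow> i = j"
      using ys(2) lt[OF 1(1)] lt[OF 1(2)] by (subst nth_eq_iff_index_eq) auto
    thus ?case by (simp only: w(1))
  next
    case (2 i)
    thus ?case using d_nonneg by (simp only: w(2) sv) (simp add: g_def)
  next
    case (3 i j)
    hence ij: "i \<in> {1..CARD('k)}" "j \<in> {1..CARD('k)}" by auto
    have "sorted (rev (map g ys))" using ys(3) by (simp add: rev_map)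
    hence "map g ys ! (j - 1) \<le> map g ys ! (i - 1)"
      using lt[OF ij(2)] 3(2) by (intro sorted_rev_nth_mono) auto
    thus ?case by (simp only: sv[OF ij(1)] sv[OF ij(2)] nth_map[OF lt] ij)
  next
    case (4 i)
    thus ?case using d_nonneg by (simp only: sv) (simp add: g_def)
  qed
qed

text \<open>Cauchy-Schwarz in every row; \<open>norm M\<close> is the Frobenius norm.\<close>

lemma norm_matrix_vector_mult_le:
  fixes M :: "real^'k^'m"
  shows "norm (M *v w) \<le> norm M * norm w"
proof -
  have "norm (M *v w) = L2_set (\<lambda>i. \<bar>M $ i \<bullet> w\<bar>) UNIV"
    by (simp add: norm_vec_def matrix_vector_mul_component)
  also have "\<dots> \<le> L2_set (\<lambda>i. norm (M $ i) * norm w) UNIV"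
    by (intro L2_set_mono) (auto simp: Cauchy_Schwarz_ineq2)
  also have "\<dots> = norm M * norm w"
    by (simp add: norm_vec_def[of M] L2_set_left_distrib)
  finally show ?thesis .
qed

lemma orthonormal_family_expansion:
  fixes u :: "nat \<Rightarrow> real^'k"
  assumes orth: "\<And>i j. i \<in> {1..CARD('k)} \<Longrightarrow> j \<in> {1..CARD('k)} \<Longrightarrow>
      u i \<bullet> u j = (if i = j then 1 else 0)"
  shows "w = (\<Sum>i\<in>{1..CARD('k)}. (u i \<bullet> w) *\<^sub>R u i)"
proof -
  let ?I = "{1..CARD('k)}"
  have inj: "inj_on u ?I"
    by (rule inj_onI) (metis orth zero_neq_one)
  have norm1: "norm (u i) = 1" if "i \<in> ?I" for i
    using orth[OF that that] by (simp add: norm_eq_1)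
  have po: "pairwise orthogonal (u ` ?I)"
    using orth by (auto simp: pairwise_def orthogonal_def)
  have "independent (u ` ?I)"
    using po norm1 by (intro pairwise_orthogonal_independent) (auto, metis atLeastAtMost_iff norm1 norm_zero zero_neq_one One_nat_def)
  moreover have "card (u ` ?I) = CARD('k)" using inj by (simp add: card_image)
  ultimately have "span (u ` ?I) = UNIV"
    by (metis DIM_cart DIM_real card_eq_dim dim_UNIV mult.right_neutral subset_UNIV top.extremum_unique
        finite_imageI finite_atLeastAtMost order_refl)
  hence "(\<Sum>v\<in>u ` ?I. (w \<bullet> v) *\<^sub>R v) = w"
    by (intro orthonormal_basis_expand po finite_imageI) (use norm1 in auto)
  thus ?thesis using inj by (simp add: sum.reindex inner_commute)
qed

text \<open>One coordinate system diagonalises both quadratic forms, so extremal statements reduce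
  to comparing coefficients.\<close>

theorem singular_expansion:
  fixes M :: "real^'k^'m"
  obtains u :: "nat \<Rightarrow> real^'k"
  where "\<And>i j. i \<in> {1..CARD('k)} \<Longrightarrow> j \<in> {1..CARD('k)} \<Longrightarrow> u i \<bullet> u j = (if i = j then 1 else 0)"
    and "\<And>i. i \<in> {1..CARD('k)} \<Longrightarrow>
           (transpose M ** M) *v u i = (singular_value M i)\<^sup>2 *\<^sub>R u i"
    and "\<And>w. w = (\<Sum>i\<in>{1..CARD('k)}. (u i \<bullet> w) *\<^sub>R u i)"
    and "\<And>w. (norm w)\<^sup>2 = (\<Sum>i\<in>{1..CARD('k)}. (u i \<bullet> w)\<^sup>2)"
    and "\<And>w. (norm (M *v w))\<^sup>2 = (\<Sum>i\<in>{1..CARD('k)}. (singular_value M i)\<^sup>2 * (u i \<bullet> w)\<^sup>2)"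
proof -
  let ?I = "{1..CARD('k)}" and ?S = "transpose M ** M"
  obtain u :: "nat \<Rightarrow> real^'k"
    where orth: "\<And>i j. i \<in> ?I \<Longrightarrow> j \<in> ?I \<Longrightarrow> u i \<bullet> u j = (if i = j then 1 else 0)"
      and eig: "\<And>i. i \<in> ?I \<Longrightarrow> ?S *v u i = (singular_value M i)\<^sup>2 *\<^sub>R u i"
    by (rule singular_system[of M]) blast
  have ex: "w = (\<Sum>i\<in>?I. (u i \<bullet> w) *\<^sub>R u i)" for w
    by (rule orthonormal_family_expansion[OF orth])
  have n1: "y \<bullet> w = (\<Sum>i\<in>?I. (u i \<bullet> w) * (y \<bullet> u i))" for w y
    by (subst ex[of w]) (simp add: inner_sum_right)
  have n2: "(norm w)\<^sup>2 = (\<Sum>i\<in>?I. (u i \<bullet> w)\<^sup>2)" for w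
    using n1[of w w] by (simp add: dot_square_norm power2_eq_square inner_commute)
  have "u i \<bullet> (?S *v w) = (singular_value M i)\<^sup>2 * (u i \<bullet> w)" if "i \<in> ?I" for i w
  proof -
    have "u i \<bullet> (?S *v w) = w \<bullet> (?S *v u i)" by (simp add: inner_gram inner_commute)
    thus ?thesis by (simp add: eig[OF that] inner_commute)
  qed
  hence "w \<bullet> (?S *v w) = (\<Sum>i\<in>?I. (singular_value M i)\<^sup>2 * (u i \<bullet> w)\<^sup>2)" for w
    unfolding n1[of w "?S *v w"]
    by (intro sum.cong) (auto simp: power2_eq_square inner_commute)
  hence "(norm (M *v w))\<^sup>2 = (\<Sum>i\<in>?I. (singular_value M i)\<^sup>2 * (u i \<bullet> w)\<^sup>2)" for w
    by (simp add: inner_gram dot_square_norm)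
  with orth eig ex n2 show ?thesis by (rule that)
qed

lemma singular_value_nonneg:
  fixes M :: "real^'k^'m"
  shows "i \<in> {1..CARD('k)} \<Longrightarrow> 0 \<le> singular_value M i"
  by (rule singular_system[of M]) blast

lemma singular_value_antimono:
  fixes M :: "real^'k^'m"
  shows "1 \<le> i \<Longrightarrow> i \<le> j \<Longrightarrow> j \<le> CARD('k) \<Longrightarrow> singular_value M j \<le> singular_value M i"
  by (rule singular_system[of M]) blast

section \<open>Extremal properties of the two smallest singular values\<close>

lemma smallest_singular_value_le:
  fixes M :: "real^'k^'m"
  shows "(singular_value M CARD('k))\<^sup>2 * (norm w)\<^sup>2 \<le> (norm (M *v w))\<^sup>2"
proof -
  obtain u where *: "\<And>w. (norm w)\<^sup>2 = (\<Sum>i\<in>{1..CARD('k)}. (u i \<bullet> w)\<^sup>2)"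
    "\<And>w. (norm (M *v w))\<^sup>2 = (\<Sum>i\<in>{1..CARD('k)}. (singular_value M i)\<^sup>2 * (u i \<bullet> w)\<^sup>2)"
    by (rule singular_expansion[of M]) blast
  show ?thesis unfolding * sum_distrib_left
    by (intro sum_mono mult_right_mono power_mono singular_value_antimono singular_value_nonneg) auto
qed

lemma smallest_singular_vector:
  fixes M :: "real^'k^'m"
  obtains v where "norm v = 1" "(transpose M ** M) *v v = (singular_value M CARD('k))\<^sup>2 *\<^sub>R v"
proof -
  obtain u where u: "\<And>i j. i \<in> {1..CARD('k)} \<Longrightarrow> j \<in> {1..CARD('k)} \<Longrightarrow>
      u i \<bullet> u j = (if i = j then 1 else 0)"
    and "\<And>i. i \<in> {1..CARD('k)} \<Longrightarrow>
           (transpose M ** M) *v u i = (singular_value M i)\<^sup>2 *\<^sub>R u i"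
    by (rule singular_expansion[of M]) blast
  moreover have "CARD('k) \<in> {1..CARD('k)}" by (simp add: Suc_leI)
  ultimately show ?thesis by (metis norm_eq_1 that)
qed

lemma norm_mult_eigenvector:
  fixes M :: "real^'k^'m"
  assumes "(transpose M ** M) *v v = c *\<^sub>R v"
  shows "(norm (M *v v))\<^sup>2 = c * (norm v)\<^sup>2"
  using inner_gram[of v M v] by (simp add: assms dot_square_norm)

text \<open>The form \<open>w \<bullet> g w\<close> is nonnegative everywhere, and the hypothesis
  makes it vanish at \<open>v\<close>; hence \<open>v\<close> is in the kernel of
  \<open>g\<close>.\<close>

lemma smallest_singular_vectorI:
  fixes M :: "real^'k^'m"
  assumes "(norm (M *v v))\<^sup>2 \<le> (singular_value M CARD('k))\<^sup>2 * (norm v)\<^sup>2"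
  shows "(transpose M ** M) *v v = (singular_value M CARD('k))\<^sup>2 *\<^sub>R v"
proof -
  define c where "c = (singular_value M CARD('k))\<^sup>2"
  define g where "g = (\<lambda>w. (transpose M ** M) *v w - c *\<^sub>R w)"
  have quad: "w \<bullet> g w = (norm (M *v w))\<^sup>2 - c * (norm w)\<^sup>2" for w
    by (simp add: g_def inner_diff_right inner_gram dot_square_norm)
  have "g v = 0"
  proof (rule semidefinite_kernel[where V = UNIV and g = g and v = v])
    show "linear g" unfolding g_def by (intro linear_compose_sub matrix_vector_mul_linear linear_scaleR)
    show "x \<bullet> g y = g x \<bullet> y" for x y
      by (simp add: g_def inner_diff_left inner_diff_right inner_gram
          inner_commute[of "(transpose M ** M) *v x"]) (simp add: inner_commute)
    show "0 \<le> x \<bullet> g x" for x using smallest_singular_value_le[of M x] by (simp add: quad c_def)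
    show "v \<bullet> g v = 0"
      using smallest_singular_value_le[of M v] assms by (simp add: quad c_def)
  qed auto
  thus ?thesis by (simp add: g_def c_def)
qed

text \<open>The gap makes the smallest eigenvalue simple, so \<open>v\<close> is a multiple of the
  last basis vector and \<open>w\<close> has no component along it.\<close>

lemma second_singular_value_le:
  fixes M :: "real^'k^'m"
  assumes k: "2 \<le> CARD('k)"
    and gap: "singular_value M CARD('k) < singular_value M (CARD('k) - 1)"
    and v: "v \<noteq> 0" "(transpose M ** M) *v v = (singular_value M CARD('k))\<^sup>2 *\<^sub>R v"
    and perp: "v \<bullet> w = 0"
  shows "(singular_value M (CARD('k) - 1))\<^sup>2 * (norm w)\<^sup>2 \<le> (norm (M *v w))\<^sup>2"
proof -
  let ?I = "{1..CARD('k)}" and ?S = "transpose M ** M" and ?s = "singular_value M"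
  obtain u where eig: "\<And>i. i \<in> ?I \<Longrightarrow> ?S *v u i = (?s i)\<^sup>2 *\<^sub>R u i"
    and ex: "\<And>w. w = (\<Sum>i\<in>?I. (u i \<bullet> w) *\<^sub>R u i)"
    and nw: "\<And>w. (norm w)\<^sup>2 = (\<Sum>i\<in>?I. (u i \<bullet> w)\<^sup>2)"
    and nMw: "\<And>w. (norm (M *v w))\<^sup>2 = (\<Sum>i\<in>?I. (?s i)\<^sup>2 * (u i \<bullet> w)\<^sup>2)"
    by (rule singular_expansion[of M]) blast
  have k_in: "CARD('k) \<in> ?I" using k by simp
  have le: "?s (CARD('k) - 1) \<le> ?s i" if "i \<in> ?I" "i \<noteq> CARD('k)" for i
    using that k by (intro singular_value_antimono) auto
  have nonneg: "0 \<le> ?s i" if "i \<in> ?I" for i using that by (rule singular_value_nonneg)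
  \<comment> \<open>Eigenvectors of a symmetric matrix for different eigenvalues are
    orthogonal.\<close>
  have zero: "u i \<bullet> v = 0" if i: "i \<in> ?I" "i \<noteq> CARD('k)" for i
  proof -
    have "(?s i)\<^sup>2 * (u i \<bullet> v) = v \<bullet> (?S *v u i)" by (simp add: eig[OF i(1)] inner_commute)
    also have "\<dots> = u i \<bullet> (?S *v v)" by (simp add: inner_gram inner_commute)
    finally have "((?s i)\<^sup>2 - (?s CARD('k))\<^sup>2) * (u i \<bullet> v) = 0" by (simp add: v left_diff_distrib)
    moreover have "(?s CARD('k))\<^sup>2 < (?s i)\<^sup>2"
      using le[OF i] gap nonneg[OF k_in] by (intro power_strict_mono) auto
    ultimately show ?thesis by simp
  qed
  have "v = (\<Sum>i\<in>?I. if i = CARD('k) then (u i \<bullet> v) *\<^sub>R u i else 0)"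
    by (subst ex[of v], intro sum.cong) (auto simp: zero)
  also have "\<dots> = (u CARD('k) \<bullet> v) *\<^sub>R u CARD('k)" using k_in by simp
  finally have v_eq: "v = (u CARD('k) \<bullet> v) *\<^sub>R u CARD('k)" .
  have "(u CARD('k) \<bullet> v) * (u CARD('k) \<bullet> w) = 0"
    using perp by (subst (asm) v_eq) simp
  moreover have "u CARD('k) \<bullet> v \<noteq> 0" using v v_eq by auto
  ultimately have last: "u CARD('k) \<bullet> w = 0" by simp
  have "(?s (CARD('k) - 1))\<^sup>2 * (u i \<bullet> w)\<^sup>2 \<le> (?s i)\<^sup>2 * (u i \<bullet> w)\<^sup>2" if "i \<in> ?I" for i
  proof (cases "i = CARD('k)")
    case False
    have "0 \<le> ?s (CARD('k) - 1)" using gap nonneg[OF k_in] by simp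
    thus ?thesis using le[OF that False] by (intro mult_right_mono power_mono) auto
  qed (simp add: last)
  thus ?thesis unfolding nw nMw sum_distrib_left by (rule sum_mono)
qed

section \<open>Differentiability of the smallest singular value\<close>

text \<open>Comparison of Rayleigh quotients yields a remainder bound of exactly this quadratic
  kind.\<close>

lemma has_derivative_quadratic_remainder:
  fixes f :: "'a::real_normed_vector \<Rightarrow> 'b::real_normed_vector"
  assumes "bounded_linear f'"
    and "\<And>y. norm (f y - f x - f' (y - x)) \<le> C * (norm (y - x))\<^sup>2"
  shows "(f has_derivative f') (at x)"
  unfolding has_derivative_at_alt
proof (intro conjI allI impI)
  fix e :: real assume "0 < e"
  define d where "d = e / (\<bar>C\<bar> + 1)"
  have "norm (f y - f x - f' (y - x)) \<le> e * norm (y - x)" if "norm (y - x) < d" for y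
  proof -
    have "C * norm (y - x) \<le> (\<bar>C\<bar> + 1) * norm (y - x)" by (intro mult_right_mono) auto
    also have "\<dots> \<le> (\<bar>C\<bar> + 1) * d" using that by (intro mult_left_mono) auto
    also have "\<dots> = e" by (simp add: d_def)
    finally have "C * norm (y - x) * norm (y - x) \<le> e * norm (y - x)" by (intro mult_right_mono) auto
    thus ?thesis using assms(2)[of y] by (simp add: power2_eq_square mult.assoc)
  qed
  moreover have "d > 0" using \<open>0 < e\<close> by (simp add: d_def)
  ultimately show "\<exists>d>0. \<forall>y. norm (y - x) < d \<longrightarrow> norm (f y - f x - f' (y - x)) \<le> e * norm (y - x)"
    by blast
qed (rule assms)

text \<open>First-order perturbation of a simple eigenvalue, without differentiating eigenvectors.
  Testing \<open>N\<close> with \<open>v\<close> gives the upper estimate; testing \<open>M\<close>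
  with a minimiser of \<open>N\<close> gives the lower one. Both have the same linear term and
  differ from it by a quadratic error.\<close>

theorem smallest_singular_value_sq_has_derivative:
  fixes M :: "real^'k^'m"
  assumes k: "2 \<le> CARD('k)"
    and gap: "singular_value M CARD('k) < singular_value M (CARD('k) - 1)"
    and v: "norm v = 1" "(transpose M ** M) *v v = (singular_value M CARD('k))\<^sup>2 *\<^sub>R v"
  shows "((\<lambda>N. (singular_value N CARD('k))\<^sup>2) has_derivative (\<lambda>D. 2 * ((M *v v) \<bullet> (D *v v)))) (at M)"
proof -
  define lam \<mu> where "lam = (singular_value M CARD('k))\<^sup>2" and "\<mu> = (singular_value M (CARD('k) - 1))\<^sup>2"
  define L where "L = norm M"
  have gap': "lam < \<mu>" unfolding lam_def \<mu>_def
    using gap k by (intro power_strict_mono singular_value_nonneg) auto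
  have vv: "v \<bullet> v = 1" using v by (simp add: dot_square_norm)
  have v0: "v \<noteq> 0" using v by auto
  show ?thesis
  \<comment> \<open>The summand 1 comes from \<open>\<delta>\<^sup>2\<close> in the upper estimate,
    the other one from completing the square in the lower estimate.\<close>
  proof (rule has_derivative_quadratic_remainder[where C = "1 + 16 * L\<^sup>2 / (\<mu> - lam)"])
    have "linear (\<lambda>D. 2 * ((M *v v) \<bullet> (D *v v)))"
      by (intro linearI)
        (simp_all add: matrix_vector_mult_add_rdistrib inner_add_right scaleR_matrix_vector_assoc[symmetric])
    thus "bounded_linear (\<lambda>D. 2 * ((M *v v) \<bullet> (D *v v)))" by (simp add: linear_conv_bounded_linear)
  next
    fix N :: "real^'k^'m"
    define D where "D = N - M"
    define \<delta> where "\<delta> = norm D"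
    have N: "N *v w = M *v w + D *v w" for w
      by (simp add: D_def matrix_vector_mult_diff_rdistrib)
    have sq: "(norm (N *v w))\<^sup>2 = (norm (M *v w))\<^sup>2 + 2 * ((M *v w) \<bullet> (D *v w)) + (norm (D *v w))\<^sup>2" for w
      unfolding N power2_norm_eq_inner by (simp add: inner_simps inner_commute)
    have cs: "\<bar>(M *v y) \<bullet> (D *v w)\<bar> \<le> L * \<delta> * (norm y * norm w)" for y w
    proof -
      have "\<bar>(M *v y) \<bullet> (D *v w)\<bar> \<le> norm (M *v y) * norm (D *v w)" by (rule Cauchy_Schwarz_ineq2)
      also have "\<dots> \<le> (L * norm y) * (\<delta> * norm w)"
        unfolding L_def \<delta>_def by (intro mult_mono norm_matrix_vector_mult_le) auto
      finally show ?thesis by (simp add: mult_ac)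
    qed
    have "(singular_value N CARD('k))\<^sup>2 \<le> (norm (N *v v))\<^sup>2"
      using smallest_singular_value_le[of N v] v by simp
    also have "\<dots> \<le> lam + 2 * ((M *v v) \<bullet> (D *v v)) + \<delta>\<^sup>2"
    proof -
      have "norm (D *v v) \<le> \<delta>" using norm_matrix_vector_mult_le[of D v] v by (simp add: \<delta>_def)
      hence "(norm (D *v v))\<^sup>2 \<le> \<delta>\<^sup>2" by (intro power_mono) auto
      moreover have "(norm (M *v v))\<^sup>2 = lam" using norm_mult_eigenvector[OF v(2)] v by (simp add: lam_def)
      ultimately show ?thesis by (simp add: sq)
    qed
    finally have upper: "(singular_value N CARD('k))\<^sup>2 \<le> lam + 2 * ((M *v v) \<bullet> (D *v v)) + \<delta>\<^sup>2" .

    \<comment> \<open>A unit minimiser for \<open>N\<close> differs from a multiple of \<open>v\<close> by a vector of length \<open>p\<close>; the gap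
      penalises \<open>p\<close> quadratically and the perturbation gains at most linearly in \<open>p\<close>.\<close>
    obtain w where w: "norm w = 1" "(transpose N ** N) *v w = (singular_value N CARD('k))\<^sup>2 *\<^sub>R w"
      by (rule smallest_singular_vector)
    define a where "a = v \<bullet> w"
    define q where "q = w - a *\<^sub>R v"
    define p where "p = norm q"
    have vq: "v \<bullet> q = 0" by (simp add: q_def a_def inner_diff_right vv)
    have w_eq: "w = a *\<^sub>R v + q" by (simp add: q_def)
    have ap: "a\<^sup>2 + p\<^sup>2 = 1"
    proof -
      have "(norm w)\<^sup>2 = a\<^sup>2 + p\<^sup>2"
        unfolding w_eq p_def power2_norm_eq_inner
        using vq by (simp add: inner_simps vv inner_commute power2_eq_square)
      thus ?thesis using w by simp
    qed
    have a2: "a\<^sup>2 = 1 - p\<^sup>2" using ap by simp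
    have "p\<^sup>2 \<le> 1" using ap zero_le_power2[of a] by linarith
    hence p: "0 \<le> p" "p \<le> 1" by (simp_all add: abs_square_le_1 p_def)
    have "a\<^sup>2 \<le> 1" using a2 by simp
    hence a: "\<bar>a\<bar> \<le> 1" by (simp add: abs_square_le_1)
    \<comment> \<open>As \<open>v\<close> is an eigenvector of the Gram matrix, its orthogonality to
      \<open>q\<close> survives the application of \<open>M\<close>, which removes the cross
      term.\<close>
    have MvMq: "(M *v v) \<bullet> (M *v q) = 0"
      using inner_gram[of q M v] v vq by (simp add: inner_commute)
    have "(norm (M *v w))\<^sup>2 = a\<^sup>2 * (norm (M *v v))\<^sup>2 + (norm (M *v q))\<^sup>2"
      unfolding w_eq power2_norm_eq_inner
      using MvMq by (simp add: matrix_vector_right_distrib matrix_vector_mult_scaleR inner_simps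
          inner_commute power2_eq_square)
    also have "\<dots> \<ge> a\<^sup>2 * lam + \<mu> * p\<^sup>2"
      using second_singular_value_le[OF k gap v0 v(2) vq] norm_mult_eigenvector[OF v(2)] v
      by (auto simp: lam_def \<mu>_def p_def)
    finally have Mw: "lam + (\<mu> - lam) * p\<^sup>2 \<le> (norm (M *v w))\<^sup>2"
      by (simp add: a2 algebra_simps)
    have Ld: "0 \<le> L * \<delta>" by (simp add: L_def \<delta>_def)
    \<comment> \<open>Replacing \<open>w\<close> by \<open>v\<close> leaves four error terms; since
      \<open>p\<^sup>2 \<le> p\<close>, each is at most \<open>L * \<delta> * p\<close>.\<close>
    have Dw: "(M *v v) \<bullet> (D *v v) - 4 * (L * \<delta>) * p \<le> (M *v w) \<bullet> (D *v w)"
    proof -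
      have "(M *v w) \<bullet> (D *v w) = a\<^sup>2 * ((M *v v) \<bullet> (D *v v)) + a * ((M *v v) \<bullet> (D *v q))
          + a * ((M *v q) \<bullet> (D *v v)) + (M *v q) \<bullet> (D *v q)"
        unfolding w_eq by (simp add: matrix_vector_right_distrib matrix_vector_mult_scaleR inner_simps
            power2_eq_square algebra_simps)
      also note a2
      finally have "(M *v w) \<bullet> (D *v w) = (M *v v) \<bullet> (D *v v) - p\<^sup>2 * ((M *v v) \<bullet> (D *v v))
          + a * ((M *v v) \<bullet> (D *v q)) + a * ((M *v q) \<bullet> (D *v v)) + (M *v q) \<bullet> (D *v q)"
        by (simp add: left_diff_distrib)
      moreover have "p\<^sup>2 \<le> p" using p by (simp add: power2_eq_square mult_left_le)
      moreover have "\<bar>p\<^sup>2 * ((M *v v) \<bullet> (D *v v))\<bar> \<le> p\<^sup>2 * (L * \<delta>)"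
        using cs[of v v] v by (simp add: abs_mult mult_left_mono)
      moreover have "p\<^sup>2 * (L * \<delta>) \<le> p * (L * \<delta>)" using \<open>p\<^sup>2 \<le> p\<close> Ld by (rule mult_right_mono)
      moreover have "\<bar>a * ((M *v v) \<bullet> (D *v q))\<bar> \<le> 1 * (L * \<delta> * p)"
        unfolding abs_mult using cs[of v q] v a by (intro mult_mono) (auto simp: p_def)
      moreover have "\<bar>a * ((M *v q) \<bullet> (D *v v))\<bar> \<le> 1 * (L * \<delta> * p)"
        unfolding abs_mult using cs[of q v] v a by (intro mult_mono) (auto simp: p_def)
      moreover have "\<bar>(M *v q) \<bullet> (D *v q)\<bar> \<le> p\<^sup>2 * (L * \<delta>)"
        using cs[of q q] by (simp add: p_def power2_eq_square mult_ac)
      ultimately show ?thesis by (simp add: mult_ac)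
    qed
    have "(singular_value N CARD('k))\<^sup>2 = (norm (N *v w))\<^sup>2" using norm_mult_eigenvector[OF w(2)] w by simp
    also have "\<dots> \<ge> lam + (\<mu> - lam) * p\<^sup>2 + 2 * ((M *v v) \<bullet> (D *v v)) - 8 * (L * \<delta>) * p"
      unfolding sq using Mw Dw zero_le_power2[of "norm (D *v w)"] by linarith
    finally have lower: "lam + 2 * ((M *v v) \<bullet> (D *v v)) + ((\<mu> - lam) * p\<^sup>2 - 8 * (L * \<delta>) * p)
        \<le> (singular_value N CARD('k))\<^sup>2" by simp
    \<comment> \<open>Completing the square eliminates the unknown distance
      \<open>p\<close>.\<close>
    have "- (16 * L\<^sup>2 / (\<mu> - lam) * \<delta>\<^sup>2) \<le> (\<mu> - lam) * p\<^sup>2 - 8 * (L * \<delta>) * p"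
    proof -
      have "0 \<le> ((\<mu> - lam) * p - 4 * (L * \<delta>))\<^sup>2 / (\<mu> - lam)" using gap' by simp
      also have "\<dots> = (\<mu> - lam) * p\<^sup>2 - 8 * (L * \<delta>) * p + 16 * L\<^sup>2 / (\<mu> - lam) * \<delta>\<^sup>2"
        using gap' by (simp add: field_simps power2_eq_square)
      finally show ?thesis by simp
    qed
    moreover have "0 \<le> 16 * L\<^sup>2 / (\<mu> - lam) * \<delta>\<^sup>2" using gap' by simp
    ultimately show "norm ((singular_value N CARD('k))\<^sup>2 - (singular_value M CARD('k))\<^sup>2
        - 2 * ((M *v v) \<bullet> ((N - M) *v v))) \<le> (1 + 16 * L\<^sup>2 / (\<mu> - lam)) * (norm (N - M))\<^sup>2"
      using upper lower unfolding D_def[symmetric] \<delta>_def[symmetric] lam_def[symmetric] distrib_right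
        real_norm_def abs_le_iff
      by (smt (verit) zero_le_power2)
  qed
qed

section \<open>Total least squares\<close>

definition augvec :: "real^'n \<Rightarrow> real \<Rightarrow> real^('n option)" where
  "augvec y t = (\<chi> k. case k of None \<Rightarrow> t | Some j \<Rightarrow> y $ j)"

lemma sum_UNIV_option:
  "(\<Sum>k\<in>(UNIV :: 'n::finite option set). f k) = f None + (\<Sum>j\<in>UNIV. f (Some j))"
  by (simp add: UNIV_option_conv sum.reindex)

lemma inner_augvec: "augvec y t \<bullet> augvec y' t' = y \<bullet> y' + t * t'"
  by (simp add: inner_vec_def augvec_def sum_UNIV_option)

lemma norm_augvec: "(norm (augvec y t))\<^sup>2 = (norm y)\<^sup>2 + t\<^sup>2"
  unfolding power2_norm_eq_inner by (simp add: inner_augvec power2_eq_square)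

lemma augvec_eta: "augvec (\<chi> j. w $ Some j) (w $ None) = w"
  by (simp add: vec_eq_iff augvec_def split: option.split)

lemma augvec_cases: obtains y t where "w = augvec y t"
  using augvec_eta by metis

lemma augvec_scaleR: "c *\<^sub>R augvec y t = augvec (c *\<^sub>R y) (c * t)"
  by (simp add: vec_eq_iff augvec_def split: option.split)

lemma augvec_eq_iff: "augvec y t = augvec y' t' \<longleftrightarrow> y = y' \<and> t = t'"
  by (auto simp: vec_eq_iff augvec_def split: option.split)

lemma augment_mult_augvec: "augment A b *v augvec y t = A *v y + t *\<^sub>R b"
  by (simp add: vec_eq_iff matrix_vector_mult_def augvec_def augment_def sum_UNIV_option mult.commute)

lemma transpose_augment_mult: "transpose (augment A b) *v w = augvec (transpose A *v w) (b \<bullet> w)"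
  by (simp add: vec_eq_iff matrix_vector_mult_def augvec_def augment_def transpose_def inner_vec_def
      split: option.split)

lemma norm_augment: "(norm (augment A b))\<^sup>2 = (norm A)\<^sup>2 + (norm b)\<^sup>2"
  unfolding power2_norm_eq_inner
  by (simp add: inner_vec_def augment_def sum_UNIV_option sum.distrib)

lemma linear_augment: "linear (\<lambda>p. augment (fst p) (snd p))"
  by (intro linearI) (auto simp: vec_eq_iff augment_def split: option.split)

definition outer :: "real^'m \<Rightarrow> real^'n \<Rightarrow> real^'n^'m" where
  "outer e y = (\<chi> i j. e $ i * y $ j)"

lemma outer_mult: "outer e y *v w = (y \<bullet> w) *\<^sub>R e"
  by (simp add: vec_eq_iff outer_def matrix_vector_mult_def inner_vec_def sum_distrib_left mult_ac)

text \<open>Rank-one matrices represent functionals of this form in the Frobenius inner product; the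
  adjoint of \<open>T\<close> is read off from this.\<close>

lemma inner_outer: "M \<bullet> outer e y = e \<bullet> (M *v y)"
  by (simp add: outer_def matrix_vector_mult_def inner_vec_def sum_distrib_left mult_ac)

lemma norm_outer: "(norm (outer e y))\<^sup>2 = (norm e)\<^sup>2 * (norm y)\<^sup>2"
  unfolding power2_norm_eq_inner inner_outer outer_mult by simp

section \<open>From TLS solutions to singular vectors\<close>

text \<open>A case of Cauchy interlacing under deletion of a column: the plane of the last two
  singular vectors meets the hyperplane of vectors with last entry zero, on which the augmented
  matrix acts as \<open>A\<close>.\<close>

lemma interlace_augment:
  fixes A :: "real^'n^'m"
  shows "singular_value A CARD('n) \<le> singular_value (augment A b) CARD('n)"
proof -
  let ?C = "augment A b" and ?n = "CARD('n)"
  let ?\<sigma> = "singular_value ?C"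
  have card: "CARD('n option) = ?n + 1" by simp
  obtain u :: "nat \<Rightarrow> real^('n option)"
    where orth: "\<And>i j. i \<in> {1..?n+1} \<Longrightarrow> j \<in> {1..?n+1} \<Longrightarrow> u i \<bullet> u j = (if i = j then 1 else 0)"
      and eig: "\<And>i. i \<in> {1..?n+1} \<Longrightarrow> (transpose ?C ** ?C) *v u i = (?\<sigma> i)\<^sup>2 *\<^sub>R u i"
    by (rule singular_expansion[of ?C, unfolded card]) blast
  \<comment> \<open>\<open>w\<close> is a nonzero combination of the last two singular vectors with vanishing last entry.\<close>
  define a c where "a = (if u (?n+1) $ None = 0 then 0 else u (?n+1) $ None)"
    and "c = (if u (?n+1) $ None = 0 then 1 else - (u ?n $ None))"
  define w where "w = a *\<^sub>R u ?n + c *\<^sub>R u (?n+1)"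
  have in_I: "?n \<in> {1..?n+1}" "?n + 1 \<in> {1..?n+1}" by (auto simp: Suc_leI)
  have "a\<^sup>2 + c\<^sup>2 > 0" by (simp add: a_def c_def sum_power2_gt_zero_iff)
  have nw: "(norm w)\<^sup>2 = a\<^sup>2 + c\<^sup>2"
    unfolding power2_norm_eq_inner w_def
    using orth[OF in_I(1) in_I(1)] orth[OF in_I(1) in_I(2)] orth[OF in_I(2) in_I(2)]
    by (simp add: inner_simps power2_eq_square inner_commute)
  have "(norm (?C *v w))\<^sup>2 = w \<bullet> ((transpose ?C ** ?C) *v w)"
    by (simp add: inner_gram dot_square_norm)
  also have "\<dots> = a\<^sup>2 * (?\<sigma> ?n)\<^sup>2 + c\<^sup>2 * (?\<sigma> (?n+1))\<^sup>2"
    unfolding w_def matrix_vector_right_distrib matrix_vector_mult_scaleR eig[OF in_I(1)] eig[OF in_I(2)]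
    using orth[OF in_I(1) in_I(1)] orth[OF in_I(1) in_I(2)] orth[OF in_I(2) in_I(2)]
    by (simp add: inner_simps power2_eq_square inner_commute)
  also have "\<dots> \<le> a\<^sup>2 * (?\<sigma> ?n)\<^sup>2 + c\<^sup>2 * (?\<sigma> ?n)\<^sup>2"
    by (intro add_left_mono mult_left_mono power_mono singular_value_antimono singular_value_nonneg)
      (auto simp: Suc_leI)
  also have "\<dots> = (?\<sigma> ?n)\<^sup>2 * (a\<^sup>2 + c\<^sup>2)" by (simp add: algebra_simps)
  finally have upper: "(norm (?C *v w))\<^sup>2 \<le> (?\<sigma> ?n)\<^sup>2 * (a\<^sup>2 + c\<^sup>2)" .
  have "w $ None = 0" by (simp add: w_def a_def c_def)
  then obtain y where y: "w = augvec y 0" using augvec_eta[of w] by metis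
  have "(singular_value A ?n)\<^sup>2 * (a\<^sup>2 + c\<^sup>2) \<le> (norm (?C *v w))\<^sup>2"
    using smallest_singular_value_le[of A y] nw by (simp add: y augment_mult_augvec norm_augvec)
  with upper \<open>a\<^sup>2 + c\<^sup>2 > 0\<close> have "(singular_value A ?n)\<^sup>2 \<le> (?\<sigma> ?n)\<^sup>2"
    by (meson mult_le_cancel_right_pos order_trans)
  thus ?thesis by (rule power2_le_imp_le) (auto intro: singular_value_nonneg simp: Suc_leI)
qed

text \<open>A smallest singular vector yields a feasible correction of Frobenius norm
  \<open>s\<close>, so the optimal correction is no larger. This bounds the image of
  \<open>(x, -1)\<close> by \<open>s\<close> times its length, which forces a singular
  vector.\<close>

theorem tls_solution_singular_vector:
  fixes A :: "real^'n^'m"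
  assumes gap: "singular_value (augment A b) (CARD('n) + 1) < singular_value A CARD('n)"
    and tls: "is_tls_solution A b x"
  shows "(transpose (augment A b) ** augment A b) *v augvec x (-1) =
           (singular_value (augment A b) (CARD('n) + 1))\<^sup>2 *\<^sub>R augvec x (-1)"
proof -
  define s where "s = singular_value (augment A b) (CARD('n) + 1)"
  have card: "CARD('n option) = CARD('n) + 1" by simp
  have s0: "0 \<le> s" unfolding s_def by (rule singular_value_nonneg) simp
  obtain v where v: "norm v = 1"
      "(transpose (augment A b) ** augment A b) *v v = s\<^sup>2 *\<^sub>R v"
    using smallest_singular_vector[of "augment A b"] unfolding card s_def by blast
  obtain y t where vy: "v = augvec y t" by (rule augvec_cases)
  have Cv: "norm (augment A b *v v) = s"
    using norm_mult_eigenvector[OF v(2)] v(1) s0 by (simp add: power2_eq_iff_nonneg)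
  \<comment> \<open>With \<open>t = 0\<close>, the unit vector \<open>y\<close> would be mapped by
    \<open>A\<close> to length \<open>s\<close>, below the smallest singular value of
    \<open>A\<close>.\<close>
  have "t \<noteq> 0"
  proof
    assume "t = 0"
    hence "norm (A *v y) = s" "(norm y)\<^sup>2 = 1"
      using Cv v(1) norm_augvec[of y t] by (simp_all add: vy augment_mult_augvec)
    hence "(singular_value A CARD('n))\<^sup>2 \<le> s\<^sup>2" using smallest_singular_value_le[of A y] by simp
    moreover have "s\<^sup>2 < (singular_value A CARD('n))\<^sup>2"
      using gap s0 by (intro power_strict_mono) (auto simp: s_def)
    ultimately show False by simp
  qed
  define x' e where "x' = (- 1 / t) *\<^sub>R y" and "e = b - A *v x'"
  define d where "d = 1 + (norm x')\<^sup>2"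
  have d: "d > 0" by (simp add: d_def add_pos_nonneg)
  have z': "augvec x' (-1) = (- 1 / t) *\<^sub>R v"
    using \<open>t \<noteq> 0\<close> by (simp add: vy augvec_scaleR x'_def)
  have "augment A b *v augvec x' (-1) = - e" by (simp add: augment_mult_augvec e_def)
  hence "norm e = norm (augment A b *v ((- 1 / t) *\<^sub>R v))" 
    unfolding z' by (metis norm_minus_cancel)
  also have "\<dots> = s / \<bar>t\<bar>" unfolding matrix_vector_mult_scaleR using Cv by simp
  finally have "norm e = s / \<bar>t\<bar>" .
  hence ne: "(norm e)\<^sup>2 = s\<^sup>2 / t\<^sup>2"
    by (simp add: power_divide)
  have "d = (norm (augvec x' (-1)))\<^sup>2" by (simp add: norm_augvec d_def)
  hence d_eq: "d = 1 / t\<^sup>2" unfolding z' by (simp add: v power_divide)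
  \<comment> \<open>Together these form the rank-one matrix \<open>e (x', 1)^T / d\<close>, where
    \<open>d\<close> is the squared length of \<open>(x', 1)\<close>; it distributes the residual
    \<open>e\<close> over all columns.\<close>
  define E' r' where "E' = outer ((1 / d) *\<^sub>R e) x'" and "r' = (1 / d) *\<^sub>R e"
  have "(A + E') *v x' = A *v x' + ((norm x')\<^sup>2 / d) *\<^sub>R e"
    by (simp add: E'_def matrix_vector_mult_add_rdistrib outer_mult dot_square_norm)
  also have "\<dots> = A *v x' + e - r'"
  proof -
    have "(norm x')\<^sup>2 / d = 1 - 1 / d" using d by (simp add: field_simps d_def)
    thus ?thesis by (simp only: r'_def scaleR_diff_left) simp
  qed
  also have "\<dots> = b - r'" by (simp add: e_def)
  finally have feas: "tls_feasible A b E' r'" unfolding tls_feasible_def by (metis rangeI)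
  have "(norm (augment E' r'))\<^sup>2 = (norm e)\<^sup>2 * d / d\<^sup>2"
    by (simp add: norm_augment E'_def r'_def norm_outer power_mult_distrib power_divide d_def
        add_divide_distrib distrib_left)
  also have "\<dots> = s\<^sup>2" using \<open>t \<noteq> 0\<close> unfolding ne d_eq by (simp add: power2_eq_square)
  finally have nE': "(norm (augment E' r'))\<^sup>2 = s\<^sup>2" .
  obtain E r where Er: "norm (augment E r) \<le> norm (augment E' r')" "(A + E) *v x = b - r"
    using tls feas unfolding is_tls_solution_def by blast
  \<comment> \<open>The constraint reads \<open>E x + r = b - A x\<close>. The signs differ between
    the two vectors, but their lengths agree.\<close>
  have "augment E r *v augvec x 1 = - (augment A b *v augvec x (-1))"
    using Er(2) by (simp add: augment_mult_augvec matrix_vector_mult_add_rdistrib algebra_simps)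
  hence "norm (augment A b *v augvec x (-1)) \<le> norm (augment E r) * norm (augvec x 1)"
    using norm_matrix_vector_mult_le by (metis norm_minus_cancel)
  hence "(norm (augment A b *v augvec x (-1)))\<^sup>2 \<le> (norm (augment E r))\<^sup>2 * (norm (augvec x 1))\<^sup>2"
    by (metis norm_ge_zero power_mono power_mult_distrib)
  also have "\<dots> \<le> s\<^sup>2 * (norm (augvec x (-1)))\<^sup>2"
    unfolding norm_augvec nE'[symmetric] power_minus_even[OF even_numeral] power2_minus
    by (intro mult_mono power_mono Er) auto
  finally show ?thesis
    using smallest_singular_vectorI[of "augment A b" "augvec x (-1)"] unfolding card s_def by blast
qed

section \<open>Derivative of the solution of a parametrised linear system\<close>

lemma det_differentiable:
  fixes F :: "'a::real_normed_vector \<Rightarrow> real^'n^'n"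
  assumes "\<And>i j. (\<lambda>q. F q $ i $ j) differentiable (at p)"
  shows "(\<lambda>q. det (F q)) differentiable (at p)"
proof -
  have "(\<lambda>q. \<Prod>i\<in>I. F q $ i $ f i) differentiable (at p)" if "finite I" for I and f :: "'n \<Rightarrow> 'n"
    using that by induction (auto intro: differentiable_mult assms)
  thus ?thesis unfolding det_def by (intro differentiable_sum differentiable_mult differentiable_const) auto
qed

lemma matrix_inv_inverse:
  fixes F :: "real^'n^'n"
  assumes "det F \<noteq> 0"
  shows "F ** matrix_inv F = mat 1" "matrix_inv F ** F = mat 1"
proof -
  have "\<exists>B. F ** B = mat 1 \<and> B ** F = mat 1"
    using assms unfolding invertible_det_nz[symmetric] invertible_def .
  hence "F ** matrix_inv F = mat 1 \<and> matrix_inv F ** F = mat 1"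
    unfolding matrix_inv_def by (rule someI_ex)
  thus "F ** matrix_inv F = mat 1" "matrix_inv F ** F = mat 1" by auto
qed

text \<open>Cramer's rule yields differentiability; the derivative is then forced by the product rule.\<close>

lemma linear_system_has_derivative:
  fixes F :: "'a::real_normed_vector \<Rightarrow> real^'n^'n" and c :: "'a \<Rightarrow> real^'n"
  assumes F: "(F has_derivative F') (at p)" and c: "(c has_derivative c') (at p)"
    and nz: "det (F p) \<noteq> 0"
  shows "((\<lambda>q. matrix_inv (F q) *v c q) has_derivative
           (\<lambda>h. matrix_inv (F p) *v (c' h - F' h *v (matrix_inv (F p) *v c p)))) (at p)"
proof -
  let ?X = "\<lambda>q. matrix_inv (F q) *v c q"
  define G where "G q = (\<chi> k. det (\<chi> i j. if j = k then c q $ i else F q $ i $ j) / det (F q))" for q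
  have dF: "(\<lambda>q. F q $ i $ j) differentiable (at p)" for i j
    using bounded_linear.has_derivative[OF bounded_linear_vec_nth
        bounded_linear.has_derivative[OF bounded_linear_vec_nth F]]
    unfolding differentiable_def by blast
  have dc: "(\<lambda>q. c q $ i) differentiable (at p)" for i
    using bounded_linear.has_derivative[OF bounded_linear_vec_nth c]
    unfolding differentiable_def by blast
  have dm: "(\<lambda>q. (\<chi> i j. if j = k then c q $ i else F q $ i $ j) $ i $ j) differentiable (at p)"
    for i j k by (cases "j = k") (simp_all add: dF dc)
  have ddet: "(\<lambda>q. det (F q)) differentiable (at p)" by (rule det_differentiable) (rule dF)
  have "(\<lambda>q. G q $ k) differentiable (at p)" for k
    unfolding G_def vec_lambda_beta
    by (intro differentiable_divide ddet nz det_differentiable dm)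
  hence "G differentiable (at p)"
    by (subst differentiable_componentwise_within) (auto simp: Basis_vec_def inner_axis)
  \<comment> \<open>Cramer's formula and the system itself are available only where the determinant
    is nonzero, hence near \<open>p\<close> by continuity.\<close>
  moreover have ev: "\<forall>\<^sub>F q in at p. det (F q) \<noteq> 0"
  proof -
    have "isCont (\<lambda>q. det (F q)) p" using ddet differentiable_imp_continuous_within by blast
    thus ?thesis using nz by (auto simp: isCont_def intro: tendsto_imp_eventually_ne)
  qed
  have solve: "F q *v ?X q = c q" if "det (F q) \<noteq> 0" for q
    using that by (simp add: matrix_vector_mul_assoc matrix_inv_inverse)
  have GX: "G q = ?X q" if "det (F q) \<noteq> 0" for q
    using cramer[OF that, of "?X q" "c q"] solve[OF that] by (simp add: G_def)
  ultimately obtain X' where "(G has_derivative X') (at p)" unfolding differentiable_def by blast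
  moreover have "\<forall>\<^sub>F q in at p. G q = ?X q" using ev by eventually_elim (rule GX)
  ultimately have X: "(?X has_derivative X') (at p)"
    by (rule has_derivative_transform_eventually) (use GX[OF nz] in auto)
  have "bilinear (\<lambda>(M::real^'n^'n) v. M *v v)"
    unfolding bilinear_def by (auto intro!: linearI simp: matrix_vector_mult_add_rdistrib
        scaleR_matrix_vector_assoc[symmetric] matrix_vector_right_distrib matrix_vector_mult_scaleR)
  hence "((\<lambda>q. F q *v ?X q) has_derivative (\<lambda>h. F p *v X' h + F' h *v ?X p)) (at p)"
    using bounded_bilinear.FDERIV[OF _ F X] by (simp add: bilinear_conv_bounded_bilinear)
  moreover have "\<forall>\<^sub>F q in at p. F q *v ?X q = c q" using ev by eventually_elim (rule solve)
  ultimately have "(c has_derivative (\<lambda>h. F p *v X' h + F' h *v ?X p)) (at p)"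
    by (rule has_derivative_transform_eventually) (use solve[OF nz] in auto)
  from has_derivative_unique[OF c this]
  have "F p *v X' h = c' h - F' h *v ?X p" for h by (simp add: fun_eq_iff)
  hence "X' h = matrix_inv (F p) *v (c' h - F' h *v ?X p)" for h
    using nz by (metis matrix_inv_inverse(2) matrix_vector_mul_assoc matrix_vector_mul_lid)
  hence "X' = (\<lambda>h. matrix_inv (F p) *v (c' h - F' h *v ?X p))" by blast
  thus ?thesis using X by simp
qed

section \<open>The shifted Gram matrix at the TLS solution\<close>

locale generic_tls =
  fixes A :: "real^'n^'m" and b :: "real^'m" and x :: "real^'n"
  assumes gap: "singular_value (augment A b) (CARD('n) + 1) < singular_value A CARD('n)"
    and solution: "is_tls_solution A b x"
begin

definition s :: real where "s = singular_value (augment A b) (CARD('n) + 1)"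
definition \<sigma> :: real where "\<sigma> = singular_value A CARD('n)"
definition r :: "real^'m" where "r = A *v x - b"
definition \<beta> :: real where "\<beta> = 1 + (norm x)\<^sup>2"
definition K :: "real^'n^'n" where "K = transpose A ** A - mat (s\<^sup>2)"

lemma s_nonneg: "0 \<le> s"
  unfolding s_def by (rule singular_value_nonneg) simp

lemma s_sq_less: "s\<^sup>2 < \<sigma>\<^sup>2"
  using gap s_nonneg by (intro power_strict_mono) (auto simp: s_def \<sigma>_def)

lemma \<beta>_pos: "0 < \<beta>"
  by (simp add: \<beta>_def add_pos_nonneg)

lemma augment_solution: "augment A b *v augvec x (-1) = r"
  by (simp add: augment_mult_augvec r_def)

lemma singular_vector:
  "(transpose (augment A b) ** augment A b) *v augvec x (-1) = s\<^sup>2 *\<^sub>R augvec x (-1)"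
  unfolding s_def using gap solution by (rule tls_solution_singular_vector)

text \<open>The upper block of the singular vector equation for \<open>(x, -1)\<close>.\<close>

lemma transpose_residual: "transpose A *v r = s\<^sup>2 *\<^sub>R x"
proof -
  have "(transpose (augment A b) ** augment A b) *v augvec x (-1) = augvec (transpose A *v r) (b \<bullet> r)"
    by (simp only: matrix_vector_mul_assoc[symmetric] augment_solution transpose_augment_mult)
  hence "augvec (transpose A *v r) (b \<bullet> r) = augvec (s\<^sup>2 *\<^sub>R x) (s\<^sup>2 * -1)"
    by (simp only: singular_vector augvec_scaleR)
  thus ?thesis by (simp add: augvec_eq_iff)
qed

lemma inner_residual: "r \<bullet> (A *v y) = s\<^sup>2 * (x \<bullet> y)"
  using transpose_vector_inner[of A r y] unfolding transpose_residual by simp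

lemma norm_residual: "(norm r)\<^sup>2 = s\<^sup>2 * \<beta>"
  using norm_mult_eigenvector[OF singular_vector]
  by (simp add: augment_solution norm_augvec \<beta>_def add.commute)

lemma K_mult: "K *v y = transpose A *v (A *v y) - s\<^sup>2 *\<^sub>R y"
proof -
  have "mat (s\<^sup>2) *v y = s\<^sup>2 *\<^sub>R y"
    by (simp add: vec_eq_iff matrix_vector_mult_def mat_def if_distrib if_distribR cong: if_cong)
  thus ?thesis by (simp add: K_def matrix_vector_mult_diff_rdistrib matrix_vector_mul_assoc)
qed

lemma K_quadratic: "y \<bullet> (K *v y) = (norm (A *v y))\<^sup>2 - s\<^sup>2 * (norm y)\<^sup>2"
  using transpose_vector_inner[of A "A *v y" y]
  by (simp add: K_mult inner_diff_right dot_square_norm inner_commute)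

lemma K_symmetric: "y \<bullet> (K *v w) = (K *v y) \<bullet> w"
  using transpose_vector_inner[of A "A *v y" w] transpose_vector_inner[of A "A *v w" y]
  by (simp add: K_mult inner_diff_right inner_diff_left inner_commute)

lemma K_lower: "(\<sigma>\<^sup>2 - s\<^sup>2) * (norm y)\<^sup>2 \<le> y \<bullet> (K *v y)"
  using smallest_singular_value_le[of A y] by (simp add: K_quadratic \<sigma>_def left_diff_distrib)

text \<open>In the order of symmetric matrices: if \<open>K\<close> is at least
  \<open>d > 0\<close>, then \<open>d K\<close> is at most \<open>K^2\<close>. Two uses of
  Cauchy-Schwarz replace a diagonalisation of \<open>K\<close>.\<close>

lemma K_upper: "(\<sigma>\<^sup>2 - s\<^sup>2) * (y \<bullet> (K *v y)) \<le> (norm (K *v y))\<^sup>2"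
proof -
  have le: "y \<bullet> (K *v y) \<le> norm y * norm (K *v y)" by (rule norm_cauchy_schwarz)
  have "(\<sigma>\<^sup>2 - s\<^sup>2) * norm y \<le> norm (K *v y)"
  proof (cases "y = 0")
    case False
    have "(\<sigma>\<^sup>2 - s\<^sup>2) * norm y * norm y \<le> norm (K *v y) * norm y"
      using K_lower[of y] le by (simp add: power2_eq_square mult_ac)
    thus ?thesis using False by simp
  qed simp
  hence "(\<sigma>\<^sup>2 - s\<^sup>2) * norm y * norm (K *v y) \<le> norm (K *v y) * norm (K *v y)"
    by (intro mult_right_mono) auto
  moreover have "(\<sigma>\<^sup>2 - s\<^sup>2) * (y \<bullet> (K *v y)) \<le> (\<sigma>\<^sup>2 - s\<^sup>2) * (norm y * norm (K *v y))"
    using s_sq_less by (intro mult_left_mono le) auto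
  ultimately show ?thesis by (simp add: power2_eq_square mult_ac)
qed

lemma det_K: "det K \<noteq> 0"
proof -
  have "y = 0" if "K *v y = 0" for y
  proof -
    have "(\<sigma>\<^sup>2 - s\<^sup>2) * (norm y)\<^sup>2 \<le> 0" using K_lower[of y] that by simp
    thus ?thesis using s_sq_less by (simp add: mult_le_0_iff)
  qed
  hence "\<exists>B. B ** K = mat 1" by (simp add: matrix_left_invertible_ker)
  thus ?thesis by (metis det_I det_mul mult_zero_right zero_neq_one)
qed

text \<open>Since \<open>K\<close> is invertible, this identifies \<open>x\<close> with the value of
  \<open>tls_map\<close> at \<open>(A, b)\<close>.\<close>

lemma K_solution: "K *v x = transpose A *v b"
proof -
  have "transpose A *v (A *v x) - transpose A *v b = s\<^sup>2 *\<^sub>R x"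
    using transpose_residual by (simp add: r_def matrix_vector_mult_diff_distrib)
  thus ?thesis by (simp add: K_mult algebra_simps)
qed

lemma K_inverse: "matrix_inv K *v (K *v y) = y" "K *v (matrix_inv K *v y) = y"
  by (simp_all only: matrix_vector_mul_assoc matrix_inv_inverse[OF det_K] matrix_vector_mul_lid)

section \<open>The operator in the derivative and its adjoint\<close>

text \<open>The derivative of \<open>K x - A^T b\<close> in the data with \<open>x\<close> frozen;
  the last term stems from the variation of \<open>s\<^sup>2\<close>.\<close>

definition T :: "(real^'n^'m) \<times> (real^'m) \<Rightarrow> real^'n" where
  "T h = transpose (fst h) *v r + transpose A *v (fst h *v x - snd h)
     - (2 / \<beta> * (r \<bullet> (fst h *v x - snd h))) *\<^sub>R x"

definition T_adj :: "real^'n \<Rightarrow> (real^'n^'m) \<times> (real^'m)" where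
  "T_adj y = (let q = A *v y - (2 / \<beta> * (x \<bullet> y)) *\<^sub>R r in (outer q x + outer r y, - q))"

lemma T_adjoint: "T h \<bullet> y = h \<bullet> T_adj y"
proof -
  obtain E f where h: "h = (E, f)" by fastforce
  define d where "d = E *v x - f"
  define q where "q = A *v y - (2 / \<beta> * (x \<bullet> y)) *\<^sub>R r"
  have "T h \<bullet> y = r \<bullet> (E *v y) + d \<bullet> (A *v y) - 2 / \<beta> * (r \<bullet> d) * (x \<bullet> y)"
    unfolding T_def h fst_conv snd_conv d_def[symmetric]
    by (simp add: inner_add_left inner_diff_left dot_lmul_matrix)
  also have "\<dots> = r \<bullet> (E *v y) + d \<bullet> q"
    by (simp add: q_def inner_diff_right inner_commute mult_ac)
  also have "\<dots> = h \<bullet> T_adj y"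
    unfolding h T_adj_def Let_def q_def[symmetric] inner_Pair inner_add_right inner_outer
    by (simp add: d_def inner_diff_left inner_diff_right inner_commute)
  finally show ?thesis .
qed

text \<open>\<open>q\<close> is the image of \<open>A y\<close> under the reflection in the hyperplane orthogonal to the residual,
  hence it has the same norm as \<open>A y\<close>.\<close>

lemma norm_T_adj:
  "(norm (T_adj y))\<^sup>2 = \<beta> * ((norm (A *v y))\<^sup>2 + s\<^sup>2 * (norm y)\<^sup>2) - 2 * s\<^sup>2 * (x \<bullet> y)\<^sup>2"
proof -
  define q where "q = A *v y - (2 / \<beta> * (x \<bullet> y)) *\<^sub>R r"
  have rr: "r \<bullet> r = s\<^sup>2 * \<beta>" by (simp add: dot_square_norm norm_residual)
  have "q \<bullet> r = r \<bullet> (A *v y) - 2 / \<beta> * (x \<bullet> y) * (r \<bullet> r)"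
    by (simp only: q_def inner_diff_left inner_scaleR_left inner_commute[of "A *v y"])
  \<comment> \<open>The reflection reverses the component along \<open>r\<close>, whence the minus
    sign in the final formula.\<close>
  hence qr: "q \<bullet> r = - (s\<^sup>2 * (x \<bullet> y))" using \<beta>_pos by (simp add: rr inner_residual)
  have "q \<bullet> q = (A *v y) \<bullet> (A *v y) - 2 * (2 / \<beta> * (x \<bullet> y)) * (r \<bullet> (A *v y))
      + (2 / \<beta> * (x \<bullet> y))\<^sup>2 * (r \<bullet> r)"
    by (simp add: q_def inner_diff_left inner_diff_right inner_commute power2_eq_square)
  also have "\<dots> = (norm (A *v y))\<^sup>2"
    using \<beta>_pos unfolding rr inner_residual power2_norm_eq_inner
    by (simp add: power2_eq_square field_simps)
  finally have qq: "q \<bullet> q = (norm (A *v y))\<^sup>2" .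
  have "(norm (T_adj y))\<^sup>2 = (outer q x + outer r y) \<bullet> (outer q x + outer r y) + q \<bullet> q"
    unfolding power2_norm_eq_inner T_adj_def Let_def q_def[symmetric] inner_Pair by simp
  also have "\<dots> = (q \<bullet> q) * (norm x)\<^sup>2 + 2 * (q \<bullet> r) * (x \<bullet> y) + (r \<bullet> r) * (norm y)\<^sup>2 + q \<bullet> q"
    unfolding power2_norm_eq_inner inner_add_left inner_add_right inner_outer
    by (simp add: outer_mult inner_commute algebra_simps)
  also have "\<dots> = \<beta> * (norm (A *v y))\<^sup>2 - 2 * s\<^sup>2 * (x \<bullet> y)\<^sup>2 + s\<^sup>2 * \<beta> * (norm y)\<^sup>2"
    by (simp add: qq qr rr \<beta>_def power2_eq_square algebra_simps)
  finally show ?thesis by (simp add: algebra_simps)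
qed

section \<open>Estimating the adjoint by the second smallest singular value\<close>

definition \<mu> :: real where "\<mu> = singular_value (augment A b) CARD('n)"

lemma \<sigma>_le_\<mu>: "\<sigma> \<le> \<mu>"
  unfolding \<sigma>_def \<mu>_def by (rule interlace_augment)

lemma s_less_\<mu>: "s < \<mu>"
  using gap \<sigma>_le_\<mu> by (simp add: s_def \<sigma>_def)

lemma augment_second_singular_value_le:
  assumes "augvec x (-1) \<bullet> w = 0"
  shows "\<mu>\<^sup>2 * (norm w)\<^sup>2 \<le> (norm (augment A b *v w))\<^sup>2"
proof -
  have "augvec x (-1) \<noteq> 0"
  proof
    assume "augvec x (-1) = 0"
    hence "(norm (augvec x (-1)))\<^sup>2 = 0" by simp
    thus False using \<beta>_pos by (simp add: norm_augvec \<beta>_def)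
  qed
  thus ?thesis
    using second_singular_value_le[of "augment A b" "augvec x (-1)" w] singular_vector s_less_\<mu> assms
    by (simp add: s_def \<mu>_def Suc_leI)
qed

lemma norm_T_adj_le: "(\<mu>\<^sup>2 - s\<^sup>2) * (norm (T_adj y))\<^sup>2 \<le> \<beta> * (\<mu>\<^sup>2 + s\<^sup>2) * (y \<bullet> (K *v y))"
proof -
  \<comment> \<open>The coefficient of the projection of \<open>(y, 0)\<close> onto
    \<open>(x, -1)\<close>, whose squared length is \<open>\<beta>\<close>.\<close>
  define a where "a = (x \<bullet> y) / \<beta>"
  have xy: "x \<bullet> y = a * \<beta>" using \<beta>_pos by (simp add: a_def)
  define w where "w = augvec (y - a *\<^sub>R x) a"
  define t p where "t = (norm (A *v y))\<^sup>2 - s\<^sup>2 * (a\<^sup>2 * \<beta>)" and "p = (norm y)\<^sup>2 - a\<^sup>2 * \<beta>"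
  have "augvec x (-1) \<bullet> w = 0"
    by (simp add: w_def inner_augvec inner_diff_right xy dot_square_norm) (simp add: \<beta>_def algebra_simps)
  moreover have "(norm w)\<^sup>2 = p"
  proof -
    have "(norm w)\<^sup>2 = (norm y)\<^sup>2 - 2 * a * (x \<bullet> y) + a\<^sup>2 * (norm x)\<^sup>2 + a\<^sup>2"
      unfolding w_def norm_augvec
      unfolding power2_norm_eq_inner
      by (simp add: inner_diff_left inner_diff_right inner_commute power2_eq_square)
    thus ?thesis by (simp add: xy p_def) (simp add: \<beta>_def power2_eq_square algebra_simps)
  qed
  moreover have "(norm (augment A b *v w))\<^sup>2 = t"
  proof -
    have "augment A b *v w = A *v y - a *\<^sub>R r"
      by (simp add: w_def augment_mult_augvec r_def matrix_vector_mult_diff_distrib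
          matrix_vector_mult_scaleR scaleR_diff_right)
    hence "(norm (augment A b *v w))\<^sup>2 = (norm (A *v y))\<^sup>2 - 2 * a * (r \<bullet> (A *v y)) + a\<^sup>2 * (norm r)\<^sup>2"
      unfolding power2_norm_eq_inner
      by (simp add: inner_diff_left inner_diff_right inner_commute power2_eq_square)
    thus ?thesis unfolding inner_residual norm_residual xy t_def
      by (simp add: power2_eq_square algebra_simps)
  qed
  ultimately have "\<mu>\<^sup>2 * p \<le> t" using augment_second_singular_value_le[of w] by simp
  hence "s\<^sup>2 * (\<mu>\<^sup>2 * p) \<le> s\<^sup>2 * t" by (rule mult_left_mono) simp
  \<comment> \<open>After expansion the two sides differ by
    \<open>2 * s\<^sup>2 * (t - \<mu>\<^sup>2 * p)\<close>.\<close>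
  hence "(\<mu>\<^sup>2 - s\<^sup>2) * (t + s\<^sup>2 * p) \<le> (\<mu>\<^sup>2 + s\<^sup>2) * (t - s\<^sup>2 * p)" by (simp add: algebra_simps)
  moreover have "(norm (T_adj y))\<^sup>2 = \<beta> * (t + s\<^sup>2 * p)"
    unfolding norm_T_adj xy t_def p_def by (simp add: power2_eq_square algebra_simps)
  moreover have "y \<bullet> (K *v y) = t - s\<^sup>2 * p"
    by (simp add: K_quadratic t_def p_def algebra_simps)
  ultimately show ?thesis using \<beta>_pos by (simp add: mult.left_commute mult.assoc)
qed


lemma norm_T_adj_le_K:
  "norm (T_adj y) \<le> sqrt ((\<mu>\<^sup>2 + s\<^sup>2) / (\<mu>\<^sup>2 - s\<^sup>2)) * (sqrt \<beta> / sqrt (\<sigma>\<^sup>2 - s\<^sup>2)) * norm (K *v y)"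
proof -
  have \<sigma>s: "\<sigma>\<^sup>2 - s\<^sup>2 > 0" using s_sq_less by simp
  have \<mu>s: "\<mu>\<^sup>2 - s\<^sup>2 > 0" using s_less_\<mu> s_nonneg by (simp add: power_strict_mono)
  have "(\<sigma>\<^sup>2 - s\<^sup>2) * ((\<mu>\<^sup>2 - s\<^sup>2) * (norm (T_adj y))\<^sup>2)
      \<le> (\<sigma>\<^sup>2 - s\<^sup>2) * (\<beta> * (\<mu>\<^sup>2 + s\<^sup>2) * (y \<bullet> (K *v y)))"
    using \<sigma>s norm_T_adj_le by (intro mult_left_mono) auto
  also have "\<dots> = \<beta> * (\<mu>\<^sup>2 + s\<^sup>2) * ((\<sigma>\<^sup>2 - s\<^sup>2) * (y \<bullet> (K *v y)))" by (simp only: mult_ac)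
  also have "\<dots> \<le> \<beta> * (\<mu>\<^sup>2 + s\<^sup>2) * (norm (K *v y))\<^sup>2"
    using \<beta>_pos K_upper by (intro mult_left_mono) auto
  finally have "(norm (T_adj y))\<^sup>2
      \<le> \<beta> * (\<mu>\<^sup>2 + s\<^sup>2) * (norm (K *v y))\<^sup>2 / ((\<sigma>\<^sup>2 - s\<^sup>2) * (\<mu>\<^sup>2 - s\<^sup>2))"
    using \<sigma>s \<mu>s by (simp add: pos_le_divide_eq mult_ac)
  hence "norm (T_adj y)
      \<le> sqrt (\<beta> * (\<mu>\<^sup>2 + s\<^sup>2) * (norm (K *v y))\<^sup>2 / ((\<sigma>\<^sup>2 - s\<^sup>2) * (\<mu>\<^sup>2 - s\<^sup>2)))"
    by (rule real_le_rsqrt)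
  thus ?thesis by (simp add: real_sqrt_mult real_sqrt_divide mult_ac)
qed

section \<open>Derivative of the TLS solution map\<close>

theorem tls_map_has_derivative:
  "(tls_map has_derivative (\<lambda>h. matrix_inv K *v (- T h))) (at (A, b))"
proof -
  let ?C = "\<lambda>p. augment (fst p) (snd p)"
  define c :: "(real^'n^'m) \<times> (real^'m) \<Rightarrow> real^'n" where "c p = transpose (fst p) *v snd p" for p
  define F :: "(real^'n^'m) \<times> (real^'m) \<Rightarrow> real^'n^'n"
    where "F p = transpose (fst p) ** fst p - mat ((singular_value (?C p) (CARD('n) + 1))\<^sup>2)" for p
  define v where "v = (1 / sqrt \<beta>) *\<^sub>R augvec x (-1)"
  define l where "l h = 2 / \<beta> * (r \<bullet> (fst h *v x - snd h))" for h :: "(real^'n^'m) \<times> (real^'m)"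
  have card: "CARD('n option) = CARD('n) + 1" by simp
  have sq: "sqrt \<beta> * sqrt \<beta> = \<beta>" using \<beta>_pos by simp
  have "(norm v)\<^sup>2 = 1"
    using \<beta>_pos by (simp add: v_def power_divide norm_augvec \<beta>_def add.commute)
  hence nv: "norm v = 1" by (simp add: power2_eq_1_iff) (use norm_ge_zero[of v] in linarith)
  have eig: "(transpose (augment A b) ** augment A b) *v v
      = (singular_value (augment A b) CARD('n option))\<^sup>2 *\<^sub>R v"
    unfolding card s_def[symmetric] v_def matrix_vector_mult_scaleR singular_vector
    by (simp add: mult.commute)
  \<comment> \<open>The augmented matrix has one column more than \<open>A\<close>, so its second
    smallest singular value has index \<open>CARD('n)\<close>. Interlacing carries the gap over to
    it and makes \<open>s\<^sup>2\<close> a simple eigenvalue.\<close>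
  have gap': "singular_value (augment A b) CARD('n option)
      < singular_value (augment A b) (CARD('n option) - 1)"
    using s_less_\<mu> by (simp add: s_def \<mu>_def)
  have two: "2 \<le> CARD('n option)" by (simp add: Suc_leI)
  have l_eq: "2 * ((augment A b *v v) \<bullet> (?C h *v v)) = l h" for h
    unfolding v_def matrix_vector_mult_scaleR augment_solution
    using sq by (simp add: augment_mult_augvec l_def)
  have C: "(?C has_derivative ?C) (at p)" for p
    by (intro bounded_linear_imp_has_derivative) (simp add: linear_conv_bounded_linear[symmetric] linear_augment)
  have "((\<lambda>p. (singular_value (?C p) CARD('n option))\<^sup>2) has_derivative
      (\<lambda>h. 2 * ((augment A b *v v) \<bullet> (?C h *v v)))) (at (A, b))"
    by (rule has_derivative_compose[OF C]) (use smallest_singular_value_sq_has_derivative[OF two gap' nv eig] in simp)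
  hence lam: "((\<lambda>p. (singular_value (?C p) (CARD('n) + 1))\<^sup>2) has_derivative l) (at (A, b))"
    unfolding l_eq card .
  have "linear (mat :: real \<Rightarrow> real^'n^'n)"
    by (intro linearI) (simp_all add: vec_eq_iff mat_def)
  hence "bounded_linear (mat :: real \<Rightarrow> real^'n^'n)" by (simp only: linear_conv_bounded_linear)
  hence m: "((\<lambda>p. mat ((singular_value (?C p) (CARD('n) + 1))\<^sup>2) :: real^'n^'n) has_derivative
      (\<lambda>h. mat (l h))) (at (A, b))"
    by (rule bounded_linear.has_derivative[OF _ lam])
  have t: "((\<lambda>p. transpose (fst p)) has_derivative (\<lambda>h. transpose (fst h))) (at (A, b))"
  proof (rule bounded_linear_imp_has_derivative)
    have "linear (\<lambda>h :: (real^'n^'m) \<times> (real^'m). transpose (fst h))"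
      by (intro linearI) (simp_all add: vec_eq_iff transpose_def)
    thus "bounded_linear (\<lambda>h :: (real^'n^'m) \<times> (real^'m). transpose (fst h))"
      by (simp only: linear_conv_bounded_linear)
  qed
  have "bilinear (\<lambda>(M::real^'m^'n) (N::real^'n^'m). M ** N)"
    unfolding bilinear_def
    by (auto intro!: linearI simp: matrix_add_ldistrib matrix_matrix_mult_def vec_eq_iff
        sum.distrib sum_distrib_left algebra_simps)
  hence "((\<lambda>p. transpose (fst p) ** fst p) has_derivative
      (\<lambda>h. transpose (fst (A, b)) ** fst h + transpose (fst h) ** fst (A, b))) (at (A, b))"
    unfolding bilinear_conv_bounded_bilinear
    by (rule bounded_bilinear.FDERIV[OF _ t has_derivative_fst[OF has_derivative_ident]])
  hence F: "(F has_derivative (\<lambda>h. transpose A ** fst h + transpose (fst h) ** A - mat (l h))) (at (A, b))"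
    unfolding F_def using m by (auto intro: has_derivative_diff)
  have "bilinear (\<lambda>(M::real^'m^'n) w. M *v w)"
    unfolding bilinear_def by (auto intro!: linearI simp: matrix_vector_mult_add_rdistrib
        scaleR_matrix_vector_assoc[symmetric] matrix_vector_right_distrib matrix_vector_mult_scaleR)
  hence "(c has_derivative
      (\<lambda>h. transpose (fst (A, b)) *v snd h + transpose (fst h) *v snd (A, b))) (at (A, b))"
    unfolding bilinear_conv_bounded_bilinear c_def
    by (rule bounded_bilinear.FDERIV[OF _ t has_derivative_snd[OF has_derivative_ident]])
  hence c: "(c has_derivative (\<lambda>h. transpose A *v snd h + transpose (fst h) *v b)) (at (A, b))"
    by simp
  have FA: "F (A, b) = K" by (simp add: F_def K_def s_def)
  have "matrix_inv K *v c (A, b) = x" using K_inverse(1)[of x] by (simp only: K_solution c_def fst_conv snd_conv)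
  hence "((\<lambda>p. matrix_inv (F p) *v c p) has_derivative
      (\<lambda>h. matrix_inv K *v ((transpose A *v snd h + transpose (fst h) *v b)
        - (transpose A ** fst h + transpose (fst h) ** A - mat (l h)) *v x))) (at (A, b))"
    using linear_system_has_derivative[OF F c] det_K by (simp only: FA simp_thms not_False_eq_True)
  moreover have "(transpose A *v snd h + transpose (fst h) *v b)
        - (transpose A ** fst h + transpose (fst h) ** A - mat (l h)) *v x = - T h" for h
  proof -
    have "mat (l h) *v x = l h *\<^sub>R x"
      by (simp add: vec_eq_iff matrix_vector_mult_def mat_def if_distrib if_distribR cong: if_cong)
    moreover have "T h = transpose (fst h) *v r + transpose A *v (fst h *v x - snd h) - l h *\<^sub>R x"
      by (simp only: T_def l_def)
    ultimately show ?thesis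
      unfolding matrix_vector_mult_diff_rdistrib matrix_vector_mult_add_rdistrib
        matrix_vector_mult_diff_distrib r_def matrix_vector_mul_assoc[symmetric]
      by (simp add: algebra_simps)
  qed
  moreover have "tls_map = (\<lambda>p. matrix_inv (F p) *v c p)"
    by (auto simp: tls_map_def F_def c_def fun_eq_iff)
  ultimately show ?thesis by simp
qed

section \<open>Two-sided bounds for the condition number\<close>

lemma tls_cond_eq: "tls_cond A b = onorm (\<lambda>h. matrix_inv K *v (- T h))"
  unfolding tls_cond_def frechet_derivative_at[OF tls_map_has_derivative, symmetric] ..

text \<open>Duality: for an image \<open>g\<close> put \<open>y = K^-1 g\<close>. Then the squared
  norm of \<open>g\<close> is \<open>K y \<bullet> g\<close>, symmetry of \<open>K\<close> moves
  \<open>T\<close> onto \<open>y\<close> as its adjoint, and the adjoint is bounded by the norm of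
  \<open>K y = g\<close>.\<close>

lemma tls_cond_le:
  "tls_cond A b \<le> sqrt ((\<mu>\<^sup>2 + s\<^sup>2) / (\<mu>\<^sup>2 - s\<^sup>2)) * (sqrt \<beta> / sqrt (\<sigma>\<^sup>2 - s\<^sup>2))"
  unfolding tls_cond_eq
proof (rule onorm_le)
  fix h :: "(real^'n^'m) \<times> (real^'m)"
  let ?B = "sqrt ((\<mu>\<^sup>2 + s\<^sup>2) / (\<mu>\<^sup>2 - s\<^sup>2)) * (sqrt \<beta> / sqrt (\<sigma>\<^sup>2 - s\<^sup>2))"
  define g where "g = matrix_inv K *v (- T h)"
  define y where "y = matrix_inv K *v g"
  have "norm g * norm g = (K *v y) \<bullet> g"
    by (simp only: y_def K_inverse(2) flip: power2_norm_eq_inner power2_eq_square)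
  also have "\<dots> = y \<bullet> (- T h)" by (simp only: K_symmetric[symmetric] g_def K_inverse(2))
  also have "\<dots> = - (h \<bullet> T_adj y)" by (simp add: T_adjoint inner_commute[of y])
  also have "\<dots> \<le> norm h * norm (T_adj y)"
    using Cauchy_Schwarz_ineq2[of h "T_adj y"] by linarith
  also have "\<dots> \<le> norm h * (?B * norm (K *v y))" by (intro mult_left_mono norm_T_adj_le_K) auto
  also have "\<dots> = ?B * norm h * norm g" by (simp only: y_def K_inverse(2) mult_ac)
  finally have le: "norm g * norm g \<le> ?B * norm h * norm g" .
  have "0 \<le> ?B * norm h"
    using s_less_\<mu> s_nonneg s_sq_less \<beta>_pos by (auto intro!: mult_nonneg_nonneg simp: power_mono)
  show "norm (matrix_inv K *v (- T h)) \<le> ?B * norm h"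
  proof (cases "g = 0")
    case True
    thus ?thesis using \<open>0 \<le> ?B * norm h\<close> unfolding g_def[symmetric] by simp
  next
    case False
    hence "norm g \<le> ?B * norm h" by (intro mult_right_le_imp_le[OF le]) simp
    thus ?thesis unfolding g_def .
  qed
qed

text \<open>For the last right singular vector \<open>y\<close> of \<open>A\<close>,
  \<open>K\<close> acts as the scalar \<open>d\<close>. The direction \<open>h = T_adj y\<close> is
  stretched by at least \<open>norm h / d\<close>, and \<open>norm h\<close> is at least
  \<open>sqrt (\<beta> * d)\<close>.\<close>

lemma tls_cond_ge: "sqrt \<beta> / sqrt (\<sigma>\<^sup>2 - s\<^sup>2) \<le> tls_cond A b"
proof -
  obtain y where y: "norm y = 1" "(transpose A ** A) *v y = \<sigma>\<^sup>2 *\<^sub>R y"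
    unfolding \<sigma>_def by (rule smallest_singular_vector)
  define h where "h = T_adj y"
  define g where "g = matrix_inv K *v (- T h)"
  define d where "d = \<sigma>\<^sup>2 - s\<^sup>2"
  have d: "d > 0" using s_sq_less by (simp add: d_def)
  have "K *v y = d *\<^sub>R y"
    unfolding K_mult matrix_vector_mul_assoc y(2) d_def by (simp add: scaleR_diff_left)
  hence Ky: "norm (K *v y) = d" using d y by simp
  have "(x \<bullet> y)\<^sup>2 \<le> \<beta>"
  proof -
    have "\<bar>x \<bullet> y\<bar> \<le> norm x" using Cauchy_Schwarz_ineq2[of x y] y by simp
    hence "(x \<bullet> y)\<^sup>2 \<le> (norm x)\<^sup>2" by (simp add: power2_le_iff_abs_le)
    thus ?thesis by (simp add: \<beta>_def)
  qed
  hence "s\<^sup>2 * (x \<bullet> y)\<^sup>2 \<le> s\<^sup>2 * \<beta>" by (rule mult_left_mono) simp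
  \<comment> \<open>The squared norm of \<open>h\<close> is \<open>\<beta> * (\<sigma>\<^sup>2 +
    s\<^sup>2) - 2 * s\<^sup>2 * (x \<bullet> y)\<^sup>2\<close>, and the subtracted term is at most
    \<open>2 * s\<^sup>2 * \<beta>\<close>.\<close>
  hence "\<beta> * d \<le> (norm h)\<^sup>2"
    unfolding h_def norm_T_adj norm_mult_eigenvector[OF y(2)] y(1) d_def by (simp add: algebra_simps)
  hence nh: "sqrt \<beta> * sqrt d \<le> norm h"
    by (metis norm_ge_zero real_le_lsqrt real_sqrt_le_mono real_sqrt_mult real_sqrt_pow2 real_sqrt_unique)
  hence h0: "norm h > 0" using d \<beta>_pos by (meson mult_pos_pos order_less_le_trans real_sqrt_gt_0_iff)
  have "norm h * norm h = h \<bullet> T_adj y" by (simp add: h_def flip: power2_norm_eq_inner power2_eq_square)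
  also have "\<dots> = T h \<bullet> y" by (simp only: T_adjoint)
  also have "\<dots> = - (g \<bullet> (K *v y))" unfolding K_symmetric g_def K_inverse(2) by simp
  also have "\<dots> \<le> norm g * norm (K *v y)" using Cauchy_Schwarz_ineq2[of g "K *v y"] by linarith
  also have "\<dots> \<le> tls_cond A b * norm h * d"
    unfolding Ky g_def tls_cond_eq using d
    by (intro mult_right_mono onorm has_derivative_bounded_linear[OF tls_map_has_derivative]) auto
  finally have "norm h \<le> tls_cond A b * d" using h0 by (simp add: mult_ac)
  with nh have "sqrt \<beta> * sqrt d \<le> tls_cond A b * d" by linarith
  also have "tls_cond A b * d = tls_cond A b * sqrt d * sqrt d" using d by simp
  finally show ?thesis using d by (simp add: pos_divide_le_eq flip: d_def)
qed

end

theorem theorem10: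
  fixes A :: "real^'n^'m" and b :: "real^'m" and x :: "real^'n" and \<alpha> \<rho> :: real
  assumes "CARD('n) < CARD('m)"
    and "0 < singular_value (augment A b) (CARD('n) + 1)"
    and "singular_value (augment A b) (CARD('n) + 1) < singular_value A CARD('n)"
    and "is_tls_solution A b x"
    and "\<alpha> = 1 / sqrt (1 + (norm x)\<^sup>2)"
    and "\<alpha> \<le> 1 / 2"
    and "\<rho> = singular_value (augment A b) (CARD('n) + 1) / singular_value (augment A b) CARD('n)"
  shows "sqrt (1 + (norm x)\<^sup>2) /
           sqrt ((singular_value A CARD('n))\<^sup>2 - (singular_value (augment A b) (CARD('n) + 1))\<^sup>2)
         \<le> tls_cond A b
       \<and> tls_cond A b
         < sqrt ((1 + 31 * \<rho>\<^sup>2) / (1 - \<rho>\<^sup>2)) *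
           (sqrt (1 + (norm x)\<^sup>2) /
            sqrt ((singular_value A CARD('n))\<^sup>2 - (singular_value (augment A b) (CARD('n) + 1))\<^sup>2))"
proof -
  interpret generic_tls A b x using assms(3,4) by unfold_locales
  have s: "0 < s" using assms(2) by (simp add: s_def)
  have \<mu>: "0 < \<mu>" "s\<^sup>2 < \<mu>\<^sup>2" using s s_less_\<mu> by (auto intro: power_strict_mono)
  have \<rho>: "\<rho> = s / \<mu>" using assms(7) by (simp add: s_def \<mu>_def)
  have pos: "0 < \<rho>\<^sup>2" "\<rho>\<^sup>2 < 1" using s \<mu> by (auto simp: \<rho> power_divide)
  have "1 + \<rho>\<^sup>2 = (\<mu>\<^sup>2 + s\<^sup>2) / \<mu>\<^sup>2" "1 - \<rho>\<^sup>2 = (\<mu>\<^sup>2 - s\<^sup>2) / \<mu>\<^sup>2"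
    using \<mu> by (simp_all add: \<rho> power_divide add_divide_distrib diff_divide_distrib)
  hence "(\<mu>\<^sup>2 + s\<^sup>2) / (\<mu>\<^sup>2 - s\<^sup>2) = (1 + \<rho>\<^sup>2) / (1 - \<rho>\<^sup>2)" using \<mu> by simp
  \<comment> \<open>The estimate in \<open>tls_cond_le\<close> has coefficient 1 where the claim has
    31; positivity of \<open>\<rho>\<close> makes the inequality strict.\<close>
  also have "\<dots> < (1 + 31 * \<rho>\<^sup>2) / (1 - \<rho>\<^sup>2)" using pos by (intro divide_strict_right_mono) auto
  finally have "sqrt ((\<mu>\<^sup>2 + s\<^sup>2) / (\<mu>\<^sup>2 - s\<^sup>2)) < sqrt ((1 + 31 * \<rho>\<^sup>2) / (1 - \<rho>\<^sup>2))" by simp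
  hence "sqrt ((\<mu>\<^sup>2 + s\<^sup>2) / (\<mu>\<^sup>2 - s\<^sup>2)) * (sqrt \<beta> / sqrt (\<sigma>\<^sup>2 - s\<^sup>2))
      < sqrt ((1 + 31 * \<rho>\<^sup>2) / (1 - \<rho>\<^sup>2)) * (sqrt \<beta> / sqrt (\<sigma>\<^sup>2 - s\<^sup>2))"
    using \<beta>_pos s_sq_less by (intro mult_strict_right_mono) auto
  with tls_cond_ge tls_cond_le show ?thesis by (auto simp: \<beta>_def \<sigma>_def s_def)
qed

end
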